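(* Let $b\in\mathbb{R}$, $\sigma>0$, $a\ge0$ with $\sigma^2\le4a$, and $T>0$. Let $Z$ be a symmetric real random variable such that $\mathbb{E}[|Z|^k]<\infty$ for all $k\in\mathbb{N}$, $\mathbb{E}[Z^2]=1$ and $\mathbb{E}[Z^4]=3$, and let $\hat Y^y_t$ be the scheme of the context. Let $m\in\mathbb{N}$ and $L\in\mathbb{N}^*$. Then there is a constant $C$ such that for all $f\in\mathcal{C}^{2(m+3),L}_{\mathbf{pol}}(\mathbb{R}_+)$ and $t\in[0,T]$, $$\mathbb{E}[f(\hat Y^y_t)]=f(y)+t\mathcal{L}f(y)+\frac{t^2}{2}\mathcal{L}^2f(y)+\bar Rf(t,y),\qquad y\ge0,$$ with $\|\bar Rf(t,\cdot)\|_{m,L+3}\le Ct^3\|f\|_{2(m+3),L}$.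
   Context: $\mathbb{R}_+=[0,\infty)$, $\mathbb{N}^*=\mathbb{N}\setminus\{0\}$. $\mathcal{L}f(y)=(a-by)f'(y)+\frac12\sigma^2yf''(y)$ is the generator of the CIR process. With $\psi_b(t)=\frac{1-e^{-bt}}{b}$ ($\psi_0(t)=t$), $$\hat Y^y_t=e^{-bt/2}\Big(\sqrt{e^{-bt/2}y+\psi_b(t/2)(a-\tfrac{\sigma^2}{4})}+\tfrac{\sigma\sqrt t}{2}Z\Big)^2+\psi_b(t/2)\Big(a-\tfrac{\sigma^2}{4}\Big).$$ For $m,L\in\mathbb{N}$, $\mathcal{C}^{m,L}_{\mathbf{pol}}(\mathbb{R}_+)$ is the space of $\mathcal{C}^m$ functions $f:\mathbb{R}_+\to\mathbb{R}$ with $\|f\|_{m,L}:=\max_{0\le j\le m}\sup_{y\ge0}\frac{|f^{(j)}(y)|}{1+y^L}<\infty$. *)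

theory Defs
  imports "HOL-Probability.Probability"
begin

text \<open>
  Functions on \<open>[0,\<infinity>)\<close> are represented by total functions on the reals; every notion below
  depends only on their values on \<open>{0..}\<close>. The derivative is taken within \<open>{0..}\<close>, hence it is
  the one-sided derivative at \<open>0\<close> and the ordinary derivative at positive points.
\<close>

definition deriv_Rp :: "(real \<Rightarrow> real) \<Rightarrow> real \<Rightarrow> real" where
  "deriv_Rp f y = vector_derivative f (at y within {0..})"

lemma deriv_Rp_eqI:
  assumes "(f has_real_derivative D) (at y within {0..})" and "0 \<le> y"
  shows "deriv_Rp f y = D"
proof -
  have "at y within {0::real..} \<noteq> bot"
  proof (cases "y = 0")
    case True
    then show ?thesis
      by (simp add: at_within_Ici_at_right)
  next
    case False
    then have "y \<in> interior {0::real..}"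
      using \<open>0 \<le> y\<close> by simp
    then have "at y within {0..} = at y"
      by (rule at_within_interior)
    then show ?thesis
      by simp
  qed
  moreover have "(f has_vector_derivative D) (at y within {0..})"
    using assms(1) by (simp only: has_real_derivative_iff_has_vector_derivative)
  ultimately show ?thesis
    unfolding deriv_Rp_def by (rule vector_derivative_within)
qed

definition C_Rp :: "nat \<Rightarrow> (real \<Rightarrow> real) set" where
  "C_Rp m = {f. (\<forall>j<m. (deriv_Rp ^^ j) f differentiable_on {0..}) \<and>
                continuous_on {0..} ((deriv_Rp ^^ m) f)}"

text \<open>The norm is extended-real valued, so that it is meaningful before finiteness is known.\<close>

definition pol_norm :: "nat \<Rightarrow> nat \<Rightarrow> (real \<Rightarrow> real) \<Rightarrow> ereal" where
  "pol_norm m L f =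
     (MAX j\<in>{0..m}. SUP y\<in>{0..}. ereal (\<bar>(deriv_Rp ^^ j) f y\<bar> / (1 + y ^ L)))"

definition C_pol :: "nat \<Rightarrow> nat \<Rightarrow> (real \<Rightarrow> real) set" where
  "C_pol m L = {f \<in> C_Rp m. pol_norm m L f < \<infinity>}"

definition cir_gen :: "real \<Rightarrow> real \<Rightarrow> real \<Rightarrow> (real \<Rightarrow> real) \<Rightarrow> real \<Rightarrow> real" where
  "cir_gen a b \<sigma> f y =
     (a - b * y) * deriv_Rp f y + 1 / 2 * \<sigma>\<^sup>2 * y * (deriv_Rp ^^ 2) f y"

definition psi :: "real \<Rightarrow> real \<Rightarrow> real" where
  "psi b t = (if b = 0 then t else (1 - exp (- b * t)) / b)"

text \<open>
  The random variable is obtained by inserting \<open>Z \<omega>\<close> for the last argument.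
\<close>

definition Y_hat :: "real \<Rightarrow> real \<Rightarrow> real \<Rightarrow> real \<Rightarrow> real \<Rightarrow> real \<Rightarrow> real" where
  "Y_hat a b \<sigma> t y z =
     exp (- b * t / 2) *
       (sqrt (exp (- b * t / 2) * y + psi b (t / 2) * (a - \<sigma>\<^sup>2 / 4)) + \<sigma> * sqrt t / 2 * z)\<^sup>2
     + psi b (t / 2) * (a - \<sigma>\<^sup>2 / 4)"

end

theory Submission
  imports Defs
begin

text \<open>
  With \<open>\<kappa> = a - \<sigma>\<^sup>2 / 4\<close> the generator splits as \<open>B + \<sigma>\<^sup>2 / 8 \<cdot> A\<close>, where \<open>B f = (\<kappa> - b y) f'\<close> generates the
  deterministic flow \<open>cir_flow\<close> and \<open>A f = 2 f' + 4 y f''\<close> is the second derivative in the variable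
  \<open>sqrt y\<close>. The scheme is the Strang splitting: half a step of the flow, the map
  \<open>y \<mapsto> (sqrt y + s Z)\<^sup>2\<close> with \<open>s = \<sigma> sqrt t / 2\<close>, and half a step of the flow. Each factor is expanded by
  Taylor's formula with integral remainder, the moments of \<open>Z\<close> entering only through those of
  order 2 and 4, and the error is a sum of products of such remainders.

  The point is that the remainders preserve smoothness up to \<open>y = 0\<close> and do not lose powers of \<open>y\<close>
  beyond those coming from \<open>A\<close> and \<open>B\<close>. By symmetry of \<open>Z\<close> only the averages
  \<open>(f (y + c + 2 d sqrt y) + f (y + c - 2 d sqrt y)) / 2\<close> occur. The derivative of such an average is
  the average of \<open>f'\<close> plus \<open>2 d\<^sup>2\<close> times an integral over \<open>v \<in> [0, 1]\<close> of the averages of \<open>f''\<close> with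
  \<open>d v\<close> in place of \<open>d\<close>. Hence each derivative in \<open>y\<close> costs two derivatives of \<open>f\<close> but no growth.
\<close>

section \<open>Functions with polynomially bounded derivatives\<close>

text \<open>One constant \<open>K\<close> bounds \<open>f\<close> and its first \<open>k\<close>
  derivatives, so constants can be followed explicitly through every operation. Asserting the
  derivative existentially makes each closure property an induction on \<open>k\<close> that peels
  off one derivative; \<open>pol_bd_iff\<close> translates back to \<open>C_Rp\<close> and
  \<open>deriv_Rp\<close>.\<close>

primrec pol_bd :: "nat \<Rightarrow> nat \<Rightarrow> real \<Rightarrow> (real \<Rightarrow> real) \<Rightarrow> bool" where
  "pol_bd 0 L K f \<longleftrightarrow> (\<forall>y\<ge>0. \<bar>f y\<bar> \<le> K * (1 + y ^ L)) \<and> continuous_on {0..} f"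
| "pol_bd (Suc k) L K f \<longleftrightarrow> (\<forall>y\<ge>0. \<bar>f y\<bar> \<le> K * (1 + y ^ L)) \<and>
     (\<exists>g. (\<forall>y\<ge>0. (f has_real_derivative g y) (at y within {0..})) \<and> pol_bd k L K g)"

lemma has_real_derivative_cong_Rp:
  assumes "(f has_real_derivative D) (at y within {0..})" "0 \<le> y" "\<And>x. 0 \<le> x \<Longrightarrow> f x = g x"
  shows "(g has_real_derivative D) (at y within {0..})"
  by (rule has_field_derivative_transform_within[OF assms(1), of 1]) (use assms in auto)

lemma pol_bd_cong:
  assumes "pol_bd k L K f" "\<And>y. 0 \<le> y \<Longrightarrow> f y = g y"
  shows "pol_bd k L K g"
proof (cases k)
  case 0
  then show ?thesis
    using assms continuous_on_cong[of "{0..}" "{0..}" f g] by auto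
next
  case (Suc k')
  then obtain h where h: "\<And>y. 0 \<le> y \<Longrightarrow> (f has_real_derivative h y) (at y within {0..})"
    "pol_bd k' L K h"
    using assms(1) by auto
  have "(g has_real_derivative h y) (at y within {0..})" if "0 \<le> y" for y
    using has_real_derivative_cong_Rp[OF h(1) _ assms(2)] that by blast
  then show ?thesis
    using assms h(2) Suc by auto
qed

lemma pol_bd_bound: "pol_bd k L K f \<Longrightarrow> 0 \<le> y \<Longrightarrow> \<bar>f y\<bar> \<le> K * (1 + y ^ L)"
  by (cases k) auto

lemma pol_bd_nonneg:
  assumes "pol_bd k L K f"
  shows "0 \<le> K"
proof -
  have "0 \<le> K * (1 + 1 ^ L)"
    using pol_bd_bound[OF assms, of 1] by linarith
  then show ?thesis by simp
qed

lemma pol_bd_deriv_Rp: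
  assumes "pol_bd (Suc k) L K f"
  shows "pol_bd k L K (deriv_Rp f)"
    and "0 \<le> y \<Longrightarrow> (f has_real_derivative deriv_Rp f y) (at y within {0..})"
proof -
  from assms obtain g where g: "\<And>y. 0 \<le> y \<Longrightarrow> (f has_real_derivative g y) (at y within {0..})"
    "pol_bd k L K g" by auto
  have eq: "deriv_Rp f y = g y" if "0 \<le> y" for y
    using deriv_Rp_eqI[OF g(1)[OF that] that] .
  show "pol_bd k L K (deriv_Rp f)"
    using pol_bd_cong[OF g(2)] eq by simp
  show "0 \<le> y \<Longrightarrow> (f has_real_derivative deriv_Rp f y) (at y within {0..})"
    using g(1) eq by simp
qed

lemma pol_bd_SucI:
  assumes "\<And>y. 0 \<le> y \<Longrightarrow> \<bar>f y\<bar> \<le> K * (1 + y ^ L)"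
    and "\<And>y. 0 \<le> y \<Longrightarrow> (f has_real_derivative g y) (at y within {0..})"
    and "pol_bd k L K g"
  shows "pol_bd (Suc k) L K f"
  using assms by auto

lemma pol_bd_continuous:
  assumes "pol_bd k L K f"
  shows "continuous_on {0..} f"
proof (cases k)
  case 0
  then show ?thesis using assms by simp
next
  case (Suc k')
  then show ?thesis
    using pol_bd_deriv_Rp(2)[of k' L K f] assms
    by (auto simp: continuous_on_eq_continuous_within intro!: DERIV_continuous simp del: pol_bd.simps)
qed

lemma pol_bd_Suc_le: "pol_bd (Suc k) L K f \<Longrightarrow> pol_bd k L K f"
proof (induction k arbitrary: f)
  case 0
  then show ?case using pol_bd_continuous[OF 0] pol_bd_bound[OF 0] by simp
next
  case (Suc k)
  show ?case
    by (rule pol_bd_SucI[OF pol_bd_bound[OF Suc.prems] pol_bd_deriv_Rp(2)[OF Suc.prems]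
          Suc.IH[OF pol_bd_deriv_Rp(1)[OF Suc.prems]]])
qed

lemma pol_bd_le:
  assumes "pol_bd k L K f" "j \<le> k"
  shows "pol_bd j L K f"
  using assms(2,1) by (induction rule: inc_induct) (auto intro: pol_bd_Suc_le simp del: pol_bd.simps)

lemma pol_bd_weaken:
  assumes "pol_bd k L K f" "\<And>y. 0 \<le> y \<Longrightarrow> K * (1 + y ^ L) \<le> K' * (1 + y ^ L')"
  shows "pol_bd k L' K' f"
  using assms(1)
proof (induction k arbitrary: f)
  case 0
  then show ?case
    using assms(2) by (auto intro: order_trans)
next
  case (Suc k)
  show ?case
    by (rule pol_bd_SucI[OF order_trans[OF pol_bd_bound[OF Suc.prems] assms(2)]
          pol_bd_deriv_Rp(2)[OF Suc.prems] Suc.IH[OF pol_bd_deriv_Rp(1)[OF Suc.prems]]])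
qed

lemma pol_bd_mono:
  assumes "pol_bd k L K f" "K \<le> K'"
  shows "pol_bd k L K' f"
  by (rule pol_bd_weaken[OF assms(1)]) (use assms(2) in \<open>auto intro!: mult_right_mono\<close>)

lemma pow_le_one_plus_pow:
  assumes "0 \<le> (y::real)" "i \<le> j"
  shows "y ^ i \<le> 1 + y ^ j"
proof (cases "y \<le> 1")
  case True
  then have "y ^ i \<le> 1" using assms by (simp add: power_le_one)
  moreover have "0 \<le> y ^ j" using assms by simp
  ultimately show ?thesis by linarith
next
  case False
  then have "y ^ i \<le> y ^ j" using assms by (intro power_increasing) auto
  then show ?thesis by linarith
qed

lemma pol_bd_degree_mono:
  assumes "pol_bd k L K f" "L \<le> L'"
  shows "pol_bd k L' (2 * K) f"
proof (rule pol_bd_weaken[OF assms(1)])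
  fix y :: real assume y: "0 \<le> y"
  have "1 + y ^ L \<le> 2 * (1 + y ^ L')"
    using add_mono[OF pow_le_one_plus_pow[OF y assms(2)] zero_le_power[OF y, of L']] by simp
  from mult_left_mono[OF this pol_bd_nonneg[OF assms(1)]]
  show "K * (1 + y ^ L) \<le> 2 * K * (1 + y ^ L')"
    by (simp add: mult_ac)
qed

lemma pol_bd_add:
  assumes "pol_bd k L K f" "pol_bd k L K' g"
  shows "pol_bd k L (K + K') (\<lambda>y. f y + g y)"
  using assms
proof (induction k arbitrary: f g)
  case 0
  then show ?case
    by (auto intro!: continuous_intros simp: distrib_right intro: order_trans[OF abs_triangle_ineq] add_mono)
next
  case (Suc k)
  show ?case
  proof (rule pol_bd_SucI)
    show "\<bar>f y + g y\<bar> \<le> (K + K') * (1 + y ^ L)" if "0 \<le> y" for y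
      using pol_bd_bound[OF Suc.prems(1) that] pol_bd_bound[OF Suc.prems(2) that]
      unfolding distrib_right by linarith
    show "((\<lambda>y. f y + g y) has_real_derivative (deriv_Rp f y + deriv_Rp g y)) (at y within {0..})"
      if "0 \<le> y" for y
      using pol_bd_deriv_Rp(2)[OF Suc.prems(1) that] pol_bd_deriv_Rp(2)[OF Suc.prems(2) that]
      by (rule DERIV_add)
  qed (rule Suc.IH[OF pol_bd_deriv_Rp(1)[OF Suc.prems(1)] pol_bd_deriv_Rp(1)[OF Suc.prems(2)]])
qed

lemma pol_bd_cmult:
  assumes "pol_bd k L K f"
  shows "pol_bd k L (\<bar>c\<bar> * K) (\<lambda>y. c * f y)"
  using assms
proof (induction k arbitrary: f)
  case 0
  then show ?case
    by (auto intro!: continuous_intros simp: abs_mult mult.assoc intro: mult_left_mono)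
next
  case (Suc k)
  show ?case
  proof (rule pol_bd_SucI)
    show "\<bar>c * f y\<bar> \<le> \<bar>c\<bar> * K * (1 + y ^ L)" if "0 \<le> y" for y
      using mult_left_mono[OF pol_bd_bound[OF Suc.prems that], of "\<bar>c\<bar>"] by (simp add: abs_mult mult.assoc)
    show "((\<lambda>y. c * f y) has_real_derivative (c * deriv_Rp f y)) (at y within {0..})"
      if "0 \<le> y" for y
      using pol_bd_deriv_Rp(2)[OF Suc.prems that] by (rule DERIV_cmult)
  qed (rule Suc.IH[OF pol_bd_deriv_Rp(1)[OF Suc.prems]])
qed

text \<open>The j-th derivative of y f is y f^(j) + j f^(j-1), which explains the factor
  \<open>1 + real k\<close>. The factor 2 comes from y + y^(L+1) <= 2 (1 + y^(L+1)).\<close>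

lemma pol_bd_mult_id:
  assumes "pol_bd k L K f"
  shows "pol_bd k (Suc L) (2 * (1 + real k) * K) (\<lambda>y. y * f y)"
  using assms
proof (induction k arbitrary: f)
  have *: "\<bar>y * f y\<bar> \<le> 2 * C * (1 + y ^ Suc L)"
    if "pol_bd k L K f" "0 \<le> y" "K \<le> C" for k f y C
  proof -
    have "\<bar>y * f y\<bar> \<le> y * (K * (1 + y ^ L))"
      using mult_left_mono[OF pol_bd_bound[OF that(1,2)] that(2)] that(2) by (simp add: abs_mult)
    also have "\<dots> = K * (y + y ^ Suc L)"
      by (simp add: algebra_simps)
    also have "\<dots> \<le> K * (2 * (1 + y ^ Suc L))"
      using pow_le_one_plus_pow[OF that(2), of 1 "Suc L"] that(2) pol_bd_nonneg[OF that(1)]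
      by (intro mult_left_mono) auto
    also have "\<dots> \<le> C * (2 * (1 + y ^ Suc L))"
      using that by (intro mult_right_mono) auto
    finally show ?thesis by (simp add: algebra_simps)
  qed
  {
    case 0
    show ?case
      using *[OF 0 _ order_refl] pol_bd_continuous[OF 0] by (auto intro!: continuous_intros)
  next
    case (Suc k)
    have K: "0 \<le> K" using pol_bd_nonneg[OF Suc.prems] .
    show ?case
    proof (rule pol_bd_SucI)
      show "\<bar>y * f y\<bar> \<le> 2 * (1 + real (Suc k)) * K * (1 + y ^ Suc L)" if "0 \<le> y" for y
        using *[OF Suc.prems that, of "(1 + real (Suc k)) * K"] K by (simp add: algebra_simps)
      show "((\<lambda>y. y * f y) has_real_derivative (y * deriv_Rp f y + f y)) (at y within {0..})"
        if "0 \<le> y" for y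
        using DERIV_mult[OF DERIV_ident pol_bd_deriv_Rp(2)[OF Suc.prems that]] by (simp add: algebra_simps)
      \<comment> \<open>The product rule leaves y f' + f: the induction hypothesis handles the first
        summand, and raising the degree of \<open>f\<close> adds the further
        \<open>2 * K\<close>.\<close>
      have "pol_bd k (Suc L) (2 * (1 + real k) * K + 2 * K) (\<lambda>y. y * deriv_Rp f y + f y)"
        by (intro pol_bd_add Suc.IH pol_bd_deriv_Rp(1)[OF Suc.prems]
            pol_bd_degree_mono[OF pol_bd_Suc_le[OF Suc.prems]]) simp
      then show "pol_bd k (Suc L) (2 * (1 + real (Suc k)) * K) (\<lambda>y. y * deriv_Rp f y + f y)"
        by (simp add: algebra_simps)
    qed
  }
qed

section \<open>Translation between \<open>pol_bd\<close> and the spaces \<open>C_pol\<close> with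
  their norms\<close>

lemma C_Rp_0: "f \<in> C_Rp 0 \<longleftrightarrow> continuous_on {0..} f"
  by (simp add: C_Rp_def)

lemma C_Rp_Suc: "f \<in> C_Rp (Suc k) \<longleftrightarrow> f differentiable_on {0..} \<and> deriv_Rp f \<in> C_Rp k"
  by (auto simp: C_Rp_def All_less_Suc2 funpow_swap1 simp del: funpow.simps(2))
    (simp_all add: funpow_swap1)

lemma deriv_Rp_has_derivative:
  assumes "f differentiable_on {0..}" "0 \<le> y"
  shows "(f has_real_derivative deriv_Rp f y) (at y within {0..})"
proof -
  obtain D where "(f has_real_derivative D) (at y within {0..})"
    using assms real_differentiableE unfolding differentiable_on_def by (metis atLeast_iff)
  with deriv_Rp_eqI[OF this assms(2)] show ?thesis by simp
qed

lemma pol_bd_iff: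
  "pol_bd k L K f \<longleftrightarrow>
    f \<in> C_Rp k \<and> (\<forall>j\<le>k. \<forall>y\<ge>0. \<bar>(deriv_Rp ^^ j) f y\<bar> \<le> K * (1 + y ^ L))"
proof (induction k arbitrary: f)
  case 0
  then show ?case by (auto simp: C_Rp_0)
next
  case (Suc k)
  have split: "(\<forall>j\<le>Suc k. P j) \<longleftrightarrow> P 0 \<and> (\<forall>j\<le>k. P (Suc j))" for P
    using less_Suc_eq_le[of _ "Suc k"] less_Suc_eq_le[of _ k] All_less_Suc2[of "Suc k" P] by simp
  show ?case
  proof
    assume L: "pol_bd (Suc k) L K f"
    have "f differentiable_on {0..}"
      using pol_bd_deriv_Rp(2)[OF L] unfolding differentiable_on_def
      by (intro ballI) (auto simp only: real_differentiable_def atLeast_iff)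
    moreover note pol_bd_deriv_Rp(1)[OF L, unfolded Suc.IH] pol_bd_bound[OF L]
    ultimately show "f \<in> C_Rp (Suc k) \<and>
        (\<forall>j\<le>Suc k. \<forall>y\<ge>0. \<bar>(deriv_Rp ^^ j) f y\<bar> \<le> K * (1 + y ^ L))"
      unfolding split C_Rp_Suc by (simp add: funpow_swap1)
  next
    assume R: "f \<in> C_Rp (Suc k) \<and>
        (\<forall>j\<le>Suc k. \<forall>y\<ge>0. \<bar>(deriv_Rp ^^ j) f y\<bar> \<le> K * (1 + y ^ L))"
    show "pol_bd (Suc k) L K f"
    proof (rule pol_bd_SucI)
      show "(f has_real_derivative deriv_Rp f y) (at y within {0..})" if "0 \<le> y" for y
        using R that by (intro deriv_Rp_has_derivative) (auto simp: C_Rp_Suc)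
      show "pol_bd k L K (deriv_Rp f)"
        using R unfolding Suc.IH split C_Rp_Suc by (simp add: funpow_swap1)
    qed (use R in \<open>auto simp: split\<close>)
  qed
qed

lemma pol_norm_le_iff:
  "pol_norm k L f \<le> ereal K \<longleftrightarrow>
    (\<forall>j\<le>k. \<forall>y\<ge>0. \<bar>(deriv_Rp ^^ j) f y\<bar> \<le> K * (1 + y ^ L))"
proof -
  have pos: "0 < 1 + y ^ L" if "0 \<le> y" for y :: real
    using that by (simp add: add_pos_nonneg)
  show ?thesis
    unfolding pol_norm_def using pos
    by (auto simp: SUP_le_iff divide_le_eq)
qed

lemma pol_bd_imp_C_pol:
  assumes "pol_bd k L K f"
  shows "f \<in> C_pol k L" "pol_norm k L f \<le> ereal K"
proof -
  show *: "pol_norm k L f \<le> ereal K"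
    using assms by (simp add: pol_norm_le_iff pol_bd_iff)
  show "f \<in> C_pol k L"
    using assms le_less_trans[OF *, of \<infinity>] by (simp add: C_pol_def pol_bd_iff)
qed

lemma C_pol_imp_pol_bd:
  assumes "f \<in> C_pol k L"
  obtains K where "pol_norm k L f = ereal K" "pol_bd k L K f"
proof -
  \<comment> \<open>A single value, at j = 0 and y = 0, already rules out minus infinity; finiteness
    from above is part of \<open>C_pol\<close>, so the norm is a real number.\<close>
  have "0 \<le> ereal (\<bar>(deriv_Rp ^^ 0) f 0\<bar> / (1 + 0 ^ L))"
    by simp
  also have "\<dots> \<le> pol_norm k L f"
    unfolding pol_norm_def by (subst Max_ge_iff) (auto intro!: bexI[of _ 0] SUP_upper2[of 0])
  finally have "0 \<le> pol_norm k L f" .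
  moreover have "pol_norm k L f < \<infinity>"
    using assms by (simp add: C_pol_def)
  ultimately obtain K where K: "pol_norm k L f = ereal K"
    by (cases "pol_norm k L f") auto
  moreover have "pol_bd k L K f"
    using assms K pol_norm_le_iff[of k L f K] by (simp add: C_pol_def pol_bd_iff)
  ultimately show ?thesis by (rule that)
qed

section \<open>Differentiation under the integral sign and symmetric averages\<close>

text \<open>Dominated convergence in the shape met below: along a bounded sequence of points the
  growth factor is replaced by a constant \<open>B\<close>, leaving the random constant
  \<open>W\<close> as majorant.\<close>

lemma tendsto_integral_dominated:
  fixes h :: "nat \<Rightarrow> 'w \<Rightarrow> real"
  assumes W: "integrable M W"
    and h: "\<And>n. h n \<in> borel_measurable M"
    and lim: "\<And>\<omega>. \<omega> \<in> space M \<Longrightarrow> (\<lambda>n. h n \<omega>) \<longlonglongrightarrow> l \<omega>"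
    and bound: "\<And>n \<omega>. \<omega> \<in> space M \<Longrightarrow> \<bar>h n \<omega>\<bar> \<le> W \<omega> * B"
  shows "(\<lambda>n. \<integral>\<omega>. h n \<omega> \<partial>M) \<longlonglongrightarrow> (\<integral>\<omega>. l \<omega> \<partial>M)"
proof (rule integral_dominated_convergence[where w = "\<lambda>\<omega>. W \<omega> * B"])
  show "l \<in> borel_measurable M"
    by (rule borel_measurable_LIMSEQ_real[OF lim h])
qed (use assms in auto)

lemma pol_bd_integrable:
  assumes "integrable M W" "(\<lambda>\<omega>. G \<omega> y) \<in> borel_measurable M"
    and "\<And>\<omega>. \<omega> \<in> space M \<Longrightarrow> pol_bd k L (W \<omega>) (G \<omega>)" and "0 \<le> y"
  shows "integrable M (\<lambda>\<omega>. G \<omega> y)"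
    and "\<bar>\<integral>\<omega>. G \<omega> y \<partial>M\<bar> \<le> (\<integral>\<omega>. W \<omega> \<partial>M) * (1 + y ^ L)"
proof -
  have int: "integrable M (\<lambda>\<omega>. W \<omega> * (1 + y ^ L))"
    using assms(1) by simp
  have le: "\<bar>G \<omega> y\<bar> \<le> W \<omega> * (1 + y ^ L)" if "\<omega> \<in> space M" for \<omega>
    using pol_bd_bound[OF assms(3)[OF that] assms(4)] .
  show G: "integrable M (\<lambda>\<omega>. G \<omega> y)"
    by (rule Bochner_Integration.integrable_bound[OF int assms(2)])
      (use le in \<open>auto intro!: AE_I2 intro: order_trans[OF _ abs_ge_self]\<close>)
  have "\<bar>\<integral>\<omega>. G \<omega> y \<partial>M\<bar> \<le> (\<integral>\<omega>. \<bar>G \<omega> y\<bar> \<partial>M)"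
    by (rule integral_abs_bound)
  also have "\<dots> \<le> (\<integral>\<omega>. W \<omega> * (1 + y ^ L) \<partial>M)"
    using G int le by (intro integral_mono) auto
  finally show "\<bar>\<integral>\<omega>. G \<omega> y \<partial>M\<bar> \<le> (\<integral>\<omega>. W \<omega> \<partial>M) * (1 + y ^ L)"
    by simp
qed

text \<open>Supplies the compact interval [0, Y] on which polynomial growth becomes a uniform bound,
  as dominated convergence requires.\<close>

lemma LIMSEQ_Rp_bounded:
  fixes X :: "nat \<Rightarrow> real"
  assumes "X \<longlonglongrightarrow> x"
  obtains Y where "\<And>n. X n \<le> Y" "x \<le> Y"
proof -
  obtain K where K: "\<And>n. norm (X n) \<le> K"
    using convergent_imp_Bseq[of X] assms by (auto simp: convergent_def Bseq_def)
  then have "X n \<le> K" for n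
    using abs_le_D1 by (metis real_norm_def)
  with LIMSEQ_le_const2[OF assms] show ?thesis
    by (intro that[of K]) auto
qed

text \<open>Measurability in \<open>\<omega>\<close> is only needed for \<open>G\<close> itself: it passes to the derivatives as limits of
  difference quotients.\<close>

lemma pol_bd_integral:
  fixes G :: "'w \<Rightarrow> real \<Rightarrow> real"
  assumes "integrable M W"
    and "\<And>y. 0 \<le> y \<Longrightarrow> (\<lambda>\<omega>. G \<omega> y) \<in> borel_measurable M"
    and "\<And>\<omega>. \<omega> \<in> space M \<Longrightarrow> pol_bd k L (W \<omega>) (G \<omega>)"
  shows "pol_bd k L (\<integral>\<omega>. W \<omega> \<partial>M) (\<lambda>y. \<integral>\<omega>. G \<omega> y \<partial>M)"
  using assms(2,3)
proof (induction k arbitrary: G)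
  case (0 G)
  have "continuous_on {0..} (\<lambda>y. \<integral>\<omega>. G \<omega> y \<partial>M)"
    unfolding continuous_on_sequentially
  proof (intro allI ballI impI, elim conjE)
    fix X :: "nat \<Rightarrow> real" and x :: real
    assume X: "\<forall>n. X n \<in> {0..}" "X \<longlonglongrightarrow> x" and x: "x \<in> {0..}"
    obtain Y where Y: "\<And>n. X n \<le> Y" using LIMSEQ_Rp_bounded[OF X(2)] by blast
    show "((\<lambda>y. \<integral>\<omega>. G \<omega> y \<partial>M) \<circ> X) \<longlonglongrightarrow> (\<integral>\<omega>. G \<omega> x \<partial>M)"
      unfolding o_def
    proof (rule tendsto_integral_dominated[OF assms(1), where B = "1 + Y ^ L"])
      fix \<omega> assume w: "\<omega> \<in> space M"
      show "(\<lambda>n. G \<omega> (X n)) \<longlonglongrightarrow> G \<omega> x"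
        using pol_bd_continuous[OF 0(2)[OF w]] X x
        unfolding continuous_on_sequentially o_def by blast
      show "\<bar>G \<omega> (X n)\<bar> \<le> W \<omega> * (1 + Y ^ L)" for n
        using X(1) Y[of n] pol_bd_nonneg[OF 0(2)[OF w]]
        by (intro order_trans[OF pol_bd_bound[OF 0(2)[OF w]]] mult_left_mono add_left_mono power_mono) auto
    qed (use 0(1) X(1) in auto)
  qed
  moreover have "\<bar>\<integral>\<omega>. G \<omega> y \<partial>M\<bar> \<le> (\<integral>\<omega>. W \<omega> \<partial>M) * (1 + y ^ L)" if "0 \<le> y" for y
    using pol_bd_integrable(2)[OF assms(1) 0(1)[OF that] 0(2) that] .
  ultimately show ?case by simp
next
  case (Suc k G)
  define G' where "G' \<omega> = deriv_Rp (G \<omega>)" for \<omega>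
  have G': "pol_bd k L (W \<omega>) (G' \<omega>)"
    "\<And>y. 0 \<le> y \<Longrightarrow> (G \<omega> has_real_derivative G' \<omega> y) (at y within {0..})"
    if "\<omega> \<in> space M" for \<omega>
    using pol_bd_deriv_Rp[OF Suc.prems(2)[OF that]] unfolding G'_def by auto
  have lim: "(\<lambda>n. (G \<omega> (X n) - G \<omega> y) / (X n - y)) \<longlonglongrightarrow> G' \<omega> y"
    if "\<omega> \<in> space M" "0 \<le> y" "\<And>n. X n \<in> {0..} - {y}" "X \<longlonglongrightarrow> y" for \<omega> y X
    using G'(2)[OF that(1,2)] that(3,4)
    unfolding has_field_derivative_iff tendsto_at_iff_sequentially o_def by blast
  show ?case
  proof (rule pol_bd_SucI)
    show "\<bar>\<integral>\<omega>. G \<omega> y \<partial>M\<bar> \<le> (\<integral>\<omega>. W \<omega> \<partial>M) * (1 + y ^ L)" if "0 \<le> y" for y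
      using pol_bd_integrable(2)[OF assms(1) Suc.prems(1)[OF that] Suc.prems(2) that] .
    show "pol_bd k L (\<integral>\<omega>. W \<omega> \<partial>M) (\<lambda>y. \<integral>\<omega>. G' \<omega> y \<partial>M)"
    proof (rule Suc.IH)
      fix y :: real assume y: "0 \<le> y"
      \<comment> \<open>Approaching \<open>y\<close> from the right stays inside the half line even
        for y = 0, so the difference quotients along \<open>X\<close> exhibit the derivative as a
        limit of measurable functions.\<close>
      define X where "X n = y + 1 / real (Suc n)" for n
      have X: "X n \<in> {0..} - {y}" for n
        using y by (auto simp: X_def)
      have "X \<longlonglongrightarrow> y + 0"
        unfolding X_def by (intro tendsto_intros LIMSEQ_Suc[OF lim_1_over_n])
      then have "X \<longlonglongrightarrow> y" by simp
      show "(\<lambda>\<omega>. G' \<omega> y) \<in> borel_measurable M"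
        by (rule borel_measurable_LIMSEQ_real[OF lim[OF _ y X \<open>X \<longlonglongrightarrow> y\<close>]])
          (use X in \<open>auto intro!: borel_measurable_divide borel_measurable_diff Suc.prems(1) y\<close>)
    qed (rule G'(1))
    fix y :: real assume y: "0 \<le> y"
    show "((\<lambda>y. \<integral>\<omega>. G \<omega> y \<partial>M) has_real_derivative (\<integral>\<omega>. G' \<omega> y \<partial>M)) (at y within {0..})"
      unfolding has_field_derivative_iff tendsto_at_iff_sequentially
    proof (intro allI impI)
      fix X :: "nat \<Rightarrow> real"
      assume X: "\<forall>i. X i \<in> {0..} - {y}" "X \<longlonglongrightarrow> y"
      then have X0: "0 \<le> X n" "X n \<noteq> y" for n by auto
      obtain Y where Y: "\<And>n. X n \<le> Y" "y \<le> Y" using LIMSEQ_Rp_bounded[OF X(2)] by blast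
      have "(\<lambda>n. \<integral>\<omega>. (G \<omega> (X n) - G \<omega> y) / (X n - y) \<partial>M) \<longlonglongrightarrow> (\<integral>\<omega>. G' \<omega> y \<partial>M)"
      proof (rule tendsto_integral_dominated[OF assms(1), where B = "1 + Y ^ L"])
        fix \<omega> assume w: "\<omega> \<in> space M"
        show "(\<lambda>n. (G \<omega> (X n) - G \<omega> y) / (X n - y)) \<longlonglongrightarrow> G' \<omega> y"
          using lim[OF w y _ X(2)] X(1) by blast
        fix n
        \<comment> \<open>The mean value inequality on [0, Y] bounds all difference quotients by one
          integrable function, independently of \<open>n\<close>.\<close>
        have "norm (G \<omega> (X n) - G \<omega> y) \<le> W \<omega> * (1 + Y ^ L) * norm (X n - y)"
        proof (rule field_differentiable_bound)
          show "convex {0..Y}" by simp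
          fix z assume z: "z \<in> {0..Y}"
          then show "(G \<omega> has_real_derivative G' \<omega> z) (at z within {0..Y})"
            using DERIV_subset[OF G'(2)[OF w, of z], of "{0..Y}"] by auto
          show "norm (G' \<omega> z) \<le> W \<omega> * (1 + Y ^ L)"
            using z pol_bd_nonneg[OF G'(1)[OF w]] unfolding real_norm_def
            by (intro order_trans[OF pol_bd_bound[OF G'(1)[OF w]]] mult_left_mono add_left_mono power_mono) auto
        qed (use Y y X0 in auto)
        then show "\<bar>(G \<omega> (X n) - G \<omega> y) / (X n - y)\<bar> \<le> W \<omega> * (1 + Y ^ L)"
          using X0(2)[of n] by (simp add: abs_divide divide_le_eq)
      qed (use Suc.prems(1) X0 y in \<open>auto intro!: borel_measurable_divide borel_measurable_diff\<close>)
      moreover have "(\<integral>\<omega>. (G \<omega> (X n) - G \<omega> y) / (X n - y) \<partial>M) =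
          ((\<integral>\<omega>. G \<omega> (X n) \<partial>M) - (\<integral>\<omega>. G \<omega> y \<partial>M)) / (X n - y)" for n
        using pol_bd_integrable(1)[OF assms(1) Suc.prems(1) Suc.prems(2)] X0 y
        by (subst Bochner_Integration.integral_diff[symmetric]) auto
      ultimately show "((\<lambda>z. ((\<integral>\<omega>. G \<omega> z \<partial>M) - (\<integral>\<omega>. G \<omega> y \<partial>M)) / (z - y)) \<circ> X)
          \<longlonglongrightarrow> (\<integral>\<omega>. G' \<omega> y \<partial>M)"
        by (simp only: o_def)
    qed
  qed
qed

section \<open>Calculus on the half line and integration over the unit interval\<close>

lemma has_real_derivative_extend_Rp:
  assumes F: "continuous_on {0..} F"
    and deriv: "\<And>y. 0 < y \<Longrightarrow> (F has_real_derivative D y) (at y)"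
    and D: "continuous_on {0..} D" and "0 \<le> y"
  shows "(F has_real_derivative D y) (at y within {0..})"
proof (cases "y = 0")
  case False
  then show ?thesis
    using deriv[of y] \<open>0 \<le> y\<close> by (simp add: has_field_derivative_at_within)
next
  case True
  \<comment> \<open>The fundamental theorem needs the derivative only in the interior and continuity
    of \<open>F\<close> up to 0. Once \<open>F\<close> is a primitive of \<open>D\<close>,
    continuity of \<open>D\<close> gives the one-sided derivative at 0.\<close>
  have eq: "F 0 + integral {0..x} D = F x" if "0 \<le> x" for x
  proof -
    have "(D has_integral (F x - F 0)) {0..x}"
      using that by (intro fundamental_theorem_of_calculus_interior continuous_on_subset[OF F])
        (auto simp flip: has_real_derivative_iff_has_vector_derivative intro: deriv)
    then show ?thesis by (simp add: integral_unique)
  qed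
  have "((\<lambda>x. F 0 + integral {0..x} D) has_real_derivative (0 + D 0)) (at 0 within {0..1})"
    using integral_has_real_derivative[OF continuous_on_subset[OF D], of 0 1 0]
    by (intro DERIV_add DERIV_const) auto
  then have "((\<lambda>x. F 0 + integral {0..x} D) has_real_derivative D 0) (at 0 within {0..})"
    by (simp add: at_within_Icc_at_right at_within_Ici_at_right)
  then show ?thesis
    unfolding True by (rule has_real_derivative_cong_Rp) (auto simp: eq)
qed

text \<open>The outer function is differentiable only within the half line, so the inner one must
  map all of \<open>S\<close> there; then the one-sided derivative at 0 suffices.\<close>

lemma has_real_derivative_chain_Rp:
  assumes "\<And>z. 0 \<le> z \<Longrightarrow> (f has_real_derivative f' z) (at z within {0..})"
    and "(g has_real_derivative E) (at x within S)" and "x \<in> S" and "\<And>x. x \<in> S \<Longrightarrow> 0 \<le> g x"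
  shows "((\<lambda>x. f (g x)) has_real_derivative f' (g x) * E) (at x within S)"
proof -
  have "(f has_real_derivative f' (g x)) (at (g x) within g ` S)"
    using assms(3,4) by (intro DERIV_subset[OF assms(1)]) auto
  from DERIV_image_chain[OF this assms(2)] show ?thesis
    by (simp add: o_def)
qed

text \<open>Writing Taylor integrals as Bochner integrals over a measure lets
  \<open>pol_bd_integral\<close> serve both for them and for expectations. The total mass is 1, so
  constant bounds pass through unchanged.\<close>

abbreviation unit_measure :: "real measure" where
  "unit_measure \<equiv> restrict_space lborel {0..1}"

lemma unit_integral_FTC:
  fixes f F :: "real \<Rightarrow> real"
  assumes "\<And>x. x \<in> {0..1} \<Longrightarrow> (F has_real_derivative f x) (at x within {0..1})"
    and "continuous_on {0..1} f"
  shows "(\<integral>x. f x \<partial>unit_measure) = F 1 - F 0"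
proof -
  have "(\<integral>x. f x \<partial>unit_measure) = (\<integral>x. indicator {0..1} x *\<^sub>R f x \<partial>lborel)"
    by (rule integral_restrict_space) simp
  also have "\<dots> = F 1 - F 0"
    using assms by (intro integral_FTC_atLeastAtMost)
      (auto simp flip: has_real_derivative_iff_has_vector_derivative)
  finally show ?thesis .
qed

lemma unit_measurable:
  assumes "continuous_on {0..1} f"
  shows "(f :: real \<Rightarrow> real) \<in> borel_measurable unit_measure"
proof -
  have "sets (restrict_space borel {0..1::real}) = sets unit_measure"
    by (simp add: sets_restrict_space)
  from measurable_cong_sets[OF this refl] borel_measurable_continuous_on_restrict[OF assms]
  show ?thesis by blast
qed

lemma unit_integrable:
  assumes "continuous_on {0..1} f"
  shows "integrable unit_measure (f :: real \<Rightarrow> real)"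
  using borel_integrable_compact[OF compact_Icc assms]
  by (subst integrable_restrict_space) auto

lemma unit_integral_const: "(\<integral>x. c \<partial>unit_measure) = (c::real)"
  by (subst unit_integral_FTC[where F = "\<lambda>x. c * x"]) (auto intro!: derivative_eq_intros)

text \<open>Since 1 + y <= 2 max(1, y) and max(1, y)^L <= 1 + y^L, an affine change of argument
  costs only (2g)^L; the leading 2 absorbs the summand 1.\<close>

lemma growth_le:
  assumes "0 \<le> (x::real)" "x \<le> g * (1 + y)" "0 \<le> y" "1 \<le> g"
  shows "1 + x ^ L \<le> 2 * (2 * g) ^ L * (1 + y ^ L)"
proof -
  have "x ^ L \<le> (g * (2 * max 1 y)) ^ L"
    using assms by (intro power_mono order_trans[OF assms(2)] mult_left_mono) auto
  also have "\<dots> = (2 * g) ^ L * max 1 y ^ L"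
    by (simp add: power_mult_distrib algebra_simps)
  also have "max 1 y ^ L \<le> 1 + y ^ L"
    using assms(3) by (cases "y \<le> 1") (auto simp: max_def)
  finally have "x ^ L \<le> (2 * g) ^ L * (1 + y ^ L)"
    using assms(4) by simp
  moreover have "1 * 1 \<le> (2 * g) ^ L * (1 + y ^ L)"
    using assms(3,4) by (intro mult_mono one_le_power) auto
  ultimately show ?thesis by simp
qed

text \<open>For c = d^2 the arguments are (sqrt y + d)^2 and (sqrt y - d)^2. The shift
  \<open>c\<close> is a separate parameter because differentiation replaces \<open>d\<close> by
  \<open>d * v\<close> and leaves \<open>c\<close> alone; the family with d^2 <= c is stable under
  this.\<close>

definition sqrt_avg :: "real \<Rightarrow> real \<Rightarrow> (real \<Rightarrow> real) \<Rightarrow> real \<Rightarrow> real" where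
  "sqrt_avg c d f y = (f (y + c + 2 * d * sqrt y) + f (y + c - 2 * d * sqrt y)) / 2"

text \<open>Completing the square gives nonnegativity. Nonnegativity for one sign says that the
  cross term with the other sign is at most y + c, whence the upper bounds.\<close>

lemma sqrt_avg_arg:
  assumes "d\<^sup>2 \<le> c" "0 \<le> y"
  shows "0 \<le> y + c + 2 * d * sqrt y" "0 \<le> y + c - 2 * d * sqrt y"
    and "y + c + 2 * d * sqrt y \<le> 2 * (1 + c) * (1 + y)" "y + c - 2 * d * sqrt y \<le> 2 * (1 + c) * (1 + y)"
proof -
  have p: "0 \<le> (sqrt y + d)\<^sup>2" "0 \<le> (sqrt y - d)\<^sup>2" by simp_all
  then show *: "0 \<le> y + c + 2 * d * sqrt y" "0 \<le> y + c - 2 * d * sqrt y"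
    using assms by (simp_all add: power2_sum power2_diff algebra_simps)
  have "0 \<le> c" using assms(1) order_trans zero_le_power2 by blast
  have "0 \<le> y * c" "2 * (1 + c) * (1 + y) = 2 + 2 * c + 2 * y + 2 * (y * c)"
    using assms(2) \<open>0 \<le> c\<close> by (simp_all add: algebra_simps)
  moreover have "2 * d * sqrt y \<le> y + c" "- (2 * d * sqrt y) \<le> y + c"
    using * by linarith+
  ultimately show "y + c + 2 * d * sqrt y \<le> 2 * (1 + c) * (1 + y)" "y + c - 2 * d * sqrt y \<le> 2 * (1 + c) * (1 + y)"
    using assms(2) \<open>0 \<le> c\<close> by linarith+
qed

lemma continuous_on_Rp_compose:
  assumes "continuous_on {0..} (f :: real \<Rightarrow> real)" "continuous_on S g" "\<And>x. x \<in> S \<Longrightarrow> 0 \<le> g x"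
  shows "continuous_on S (\<lambda>x. f (g x))"
  by (rule continuous_on_compose2[OF assms(1,2)]) (use assms(3) in auto)

lemma scaled_param_le:
  fixes d :: real
  assumes "d\<^sup>2 \<le> c" "v \<in> {0..1}"
  shows "(d * v)\<^sup>2 \<le> c"
proof -
  have "(d * v)\<^sup>2 = d\<^sup>2 * v\<^sup>2" by (simp add: power_mult_distrib)
  also have "\<dots> \<le> d\<^sup>2 * 1" using assms(2) by (intro mult_left_mono) (auto simp: power_le_one)
  finally show ?thesis using assms(1) by simp
qed

lemma sqrt_avg_continuous_param:
  assumes "continuous_on {0..} f" "d\<^sup>2 \<le> c" "0 \<le> y"
  shows "continuous_on {0..1} (\<lambda>v. sqrt_avg c (d * v) f y)"
  unfolding sqrt_avg_def
  using sqrt_avg_arg(1,2)[OF scaled_param_le[OF assms(2)] assms(3)]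
  by (intro continuous_intros continuous_on_Rp_compose[OF assms(1)]) auto

lemma sqrt_avg_bound:
  assumes "pol_bd k L K f" "d\<^sup>2 \<le> c" "0 \<le> y"
  shows "\<bar>sqrt_avg c d f y\<bar> \<le> 2 * 4 ^ L * (1 + c) ^ L * K * (1 + y ^ L)"
proof -
  have c: "0 \<le> c" using assms(2) order_trans zero_le_power2 by blast
  have *: "\<bar>f z\<bar> \<le> 2 * 4 ^ L * (1 + c) ^ L * K * (1 + y ^ L)"
    if "0 \<le> z" "z \<le> 2 * (1 + c) * (1 + y)" for z
  proof -
    have "\<bar>f z\<bar> \<le> K * (1 + z ^ L)" using pol_bd_bound[OF assms(1) that(1)] .
    also have "\<dots> \<le> K * (2 * (2 * (2 * (1 + c))) ^ L * (1 + y ^ L))"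
      using c by (intro mult_left_mono growth_le that assms pol_bd_nonneg[OF assms(1)]) auto
    also have "2 * (2 * (1 + c)) = 4 * (1 + c)"
      by simp
    also have "K * (2 * (4 * (1 + c)) ^ L * (1 + y ^ L)) = 2 * 4 ^ L * (1 + c) ^ L * K * (1 + y ^ L)"
      unfolding power_mult_distrib by (simp only: mult_ac)
    finally show ?thesis .
  qed
  have avg: "\<bar>(u + v) / 2\<bar> \<le> B" if "\<bar>u\<bar> \<le> B" "\<bar>v\<bar> \<le> B" for u v B :: real
    using that by (simp add: abs_le_iff)
  show ?thesis
    unfolding sqrt_avg_def
    by (intro avg * sqrt_avg_arg assms(2,3))
qed

text \<open>Differentiating naively produces the singular factor \<open>1 / sqrt y\<close> in front of a difference
  of values of \<open>f'\<close>; writing this difference as an integral of \<open>f''\<close> cancels the singularity.\<close>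

lemma sqrt_avg_deriv:
  assumes f: "pol_bd 2 L K f" and dc: "d\<^sup>2 \<le> c" and y: "0 \<le> y"
  defines "D \<equiv> \<lambda>y. sqrt_avg c d (deriv_Rp f) y +
     2 * d\<^sup>2 * (\<integral>v. sqrt_avg c (d * v) (deriv_Rp (deriv_Rp f)) y \<partial>unit_measure)"
  shows "(sqrt_avg c d f has_real_derivative D y) (at y within {0..})"
proof (rule has_real_derivative_extend_Rp[OF _ _ _ y])
  have f1: "pol_bd (Suc 0) L K (deriv_Rp f)"
    and f2: "pol_bd 0 L K (deriv_Rp (deriv_Rp f))"
    using f pol_bd_deriv_Rp(1)[of "Suc 0" L K f] pol_bd_deriv_Rp(1)[of 0 L K "deriv_Rp f"]
    by (simp_all add: numeral_2_eq_2 del: pol_bd.simps)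
  have df: "(f has_real_derivative deriv_Rp f z) (at z within {0..})"
    and df': "(deriv_Rp f has_real_derivative deriv_Rp (deriv_Rp f) z) (at z within {0..})"
    if "0 \<le> z" for z
    using that pol_bd_deriv_Rp(2)[OF f1] pol_bd_deriv_Rp(2)[of "Suc 0" L K f] f
    by (simp_all add: numeral_2_eq_2 del: pol_bd.simps)
  have cont: "continuous_on {0..} (sqrt_avg c d g)" if "continuous_on {0..} g" "d\<^sup>2 \<le> c" for g c d
    unfolding sqrt_avg_def[abs_def]
    using sqrt_avg_arg(1,2)[OF that(2)]
    by (intro continuous_intros continuous_on_Rp_compose[OF that(1)]) auto
  show "continuous_on {0..} (sqrt_avg c d f)"
    by (rule cont[OF pol_bd_continuous[OF f] dc])
  \<comment> \<open>Continuity of \<open>D\<close> up to 0 is the case of no derivatives of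
    \<open>pol_bd_integral\<close>, applied to the average of f'' with \<open>v\<close> as
    integration variable.\<close>
  have "pol_bd 0 L (2 * 4 ^ L * (1 + c) ^ L * K) (sqrt_avg c d (deriv_Rp (deriv_Rp f)))"
    if "d\<^sup>2 \<le> c" for d
    using sqrt_avg_bound[OF f2 that] cont[OF pol_bd_continuous[OF f2] that] by simp
  then have "pol_bd 0 L (\<integral>v. 2 * 4 ^ L * (1 + c) ^ L * K \<partial>unit_measure)
     (\<lambda>y. \<integral>v. sqrt_avg c (d * v) (deriv_Rp (deriv_Rp f)) y \<partial>unit_measure)"
    using scaled_param_le[OF dc]
    by (intro pol_bd_integral unit_integrable unit_measurable sqrt_avg_continuous_param
        pol_bd_continuous[OF f2] dc) (auto simp: space_restrict_space simp del: pol_bd.simps)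
  from pol_bd_continuous[OF this] show "continuous_on {0..} D"
    unfolding D_def by (intro continuous_intros cont[OF pol_bd_continuous[OF f1] dc])
  fix y :: real assume y: "0 < y"
  define p q where "p = y + c" and "q = 2 * d * sqrt y"
  have q: "2 * d * v * sqrt y = q * v" "2 * (d * v) * sqrt y = q * v" for v by (simp_all add: q_def)
  have arg: "0 \<le> p + q * v" "0 \<le> p - q * v" if "v \<in> {0..1}" for v
    using sqrt_avg_arg(1,2)[OF scaled_param_le[OF dc that], of y] y unfolding p_def q_def
    by (simp_all add: mult_ac)
  \<comment> \<open>In \<open>v\<close>, the difference f'(p + q v) - f'(p - q v) has derivative 2 q
    times the average of f'', and it vanishes at v = 0.\<close>
  have "(\<integral>v. sqrt_avg c (d * v) (deriv_Rp (deriv_Rp f)) y * (2 * q) \<partial>unit_measure) =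
      (deriv_Rp f (p + q * 1) - deriv_Rp f (p - q * 1)) - (deriv_Rp f (p + q * 0) - deriv_Rp f (p - q * 0))"
  proof (rule unit_integral_FTC)
    fix v :: real assume v: "v \<in> {0..1}"
    have "((\<lambda>v. deriv_Rp f (p + q * v)) has_real_derivative deriv_Rp (deriv_Rp f) (p + q * v) * q) (at v within {0..1})"
      by (rule has_real_derivative_chain_Rp[OF df' _ v])
         (use arg in \<open>auto intro!: derivative_eq_intros\<close>)
    moreover have "((\<lambda>v. deriv_Rp f (p - q * v)) has_real_derivative deriv_Rp (deriv_Rp f) (p - q * v) * (-q)) (at v within {0..1})"
      by (rule has_real_derivative_chain_Rp[OF df' _ v])
         (use arg in \<open>auto intro!: derivative_eq_intros\<close>)
    ultimately show "((\<lambda>v. deriv_Rp f (p + q * v) - deriv_Rp f (p - q * v)) has_real_derivative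
        sqrt_avg c (d * v) (deriv_Rp (deriv_Rp f)) y * (2 * q)) (at v within {0..1})"
      by (rule DERIV_diff[THEN DERIV_cong]) (simp add: sqrt_avg_def q p_def[symmetric]; simp add: algebra_simps)
  qed (use sqrt_avg_continuous_param[OF pol_bd_continuous[OF f2] dc] y in \<open>auto intro!: continuous_intros\<close>)
  then have int: "2 * q * (\<integral>v. sqrt_avg c (d * v) (deriv_Rp (deriv_Rp f)) y \<partial>unit_measure) =
      deriv_Rp f (p + q) - deriv_Rp f (p - q)"
    by (simp add: mult.commute)
  \<comment> \<open>The open half line is a set on which both arguments stay nonnegative, as the
    chain rule demands, and at y > 0 it gives the ordinary derivative.\<close>
  have sy: "((\<lambda>y. y + c + e * sqrt y) has_real_derivative (1 + e * (inverse (sqrt y) / 2))) (at y within {0<..})" for e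
    using y by (auto intro!: derivative_eq_intros)
  have "((\<lambda>y. f (y + c + (2 * d) * sqrt y)) has_real_derivative
      deriv_Rp f (y + c + 2 * d * sqrt y) * (1 + 2 * d * (inverse (sqrt y) / 2))) (at y within {0<..})"
    by (rule has_real_derivative_chain_Rp[OF df sy]) (use y sqrt_avg_arg(1)[OF dc] in auto)
  moreover have "((\<lambda>y. f (y + c + (- 2 * d) * sqrt y)) has_real_derivative
      deriv_Rp f (y + c + (- 2 * d) * sqrt y) * (1 + (- 2 * d) * (inverse (sqrt y) / 2))) (at y within {0<..})"
    by (rule has_real_derivative_chain_Rp[OF df sy]) (use y sqrt_avg_arg(2)[OF dc] in auto)
  ultimately have "((\<lambda>y. (f (y + c + (2 * d) * sqrt y) + f (y + c + (- 2 * d) * sqrt y)) / 2) has_real_derivative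
      (deriv_Rp f (p + q) * (1 + d * inverse (sqrt y)) + deriv_Rp f (p - q) * (1 - d * inverse (sqrt y))) / 2)
      (at y within {0<..})"
    by (intro DERIV_cdivide DERIV_add[THEN DERIV_cong]) (auto simp: p_def q_def)
  moreover have "(deriv_Rp f (p + q) * (1 + d * inverse (sqrt y)) + deriv_Rp f (p - q) * (1 - d * inverse (sqrt y))) / 2
     = sqrt_avg c d (deriv_Rp f) y + d * inverse (sqrt y) / 2 * (deriv_Rp f (p + q) - deriv_Rp f (p - q))"
    unfolding sqrt_avg_def p_def[symmetric] q_def[symmetric] by algebra
  \<comment> \<open>With q = 2 d sqrt y, the product of d / (2 sqrt y) and 2 q is 2 d^2: the
    singular factor is gone.\<close>
  moreover have "\<dots> = D y"
    unfolding int[symmetric] D_def using y by (simp add: q_def power2_eq_square)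
  ultimately show "(sqrt_avg c d f has_real_derivative D y) (at y)"
    using y at_within_open[of y "{0<..}"] by (simp add: sqrt_avg_def[abs_def])
qed

text \<open>Induction on \<open>k\<close> with \<open>d\<close> generalised, because the derivative
  formula involves all \<open>d * v\<close>. Each step passes to f' and f'', hence the
  \<open>2 * k\<close>; the growth exponent stays \<open>L\<close>.\<close>

lemma pol_bd_sqrt_avg:
  assumes "pol_bd (2 * k) L K f" "d\<^sup>2 \<le> c"
  shows "pol_bd k L (2 * 4 ^ L * 3 ^ k * (1 + c) ^ (L + k) * K) (sqrt_avg c d f)"
  using assms
proof (induction k arbitrary: f d)
  case 0
  have "continuous_on {0..} (sqrt_avg c d f)"
    unfolding sqrt_avg_def[abs_def]
    using sqrt_avg_arg(1,2)[OF 0(2)]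
    by (intro continuous_intros continuous_on_Rp_compose[OF pol_bd_continuous[OF 0(1)]]) auto
  then show ?case
    using sqrt_avg_bound[OF 0(1,2)] by simp
next
  case (Suc k)
  have c: "0 \<le> c" using Suc.prems(2) order_trans zero_le_power2 by blast
  have K: "0 \<le> K" using pol_bd_nonneg[OF Suc.prems(1)] .
  define C where "C = 2 * 4 ^ L * 3 ^ k * (1 + c) ^ (L + k) * K"
  have C: "0 \<le> C" using c K by (simp add: C_def)
  have f1: "pol_bd (Suc (2 * k)) L K (deriv_Rp f)"
    and f2: "pol_bd (2 * k) L K (deriv_Rp (deriv_Rp f))"
    using Suc.prems(1) pol_bd_deriv_Rp(1)[of "Suc (2 * k)" L K f] pol_bd_deriv_Rp(1)[of "2 * k" L K "deriv_Rp f"]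
    by (simp_all del: pol_bd.simps)
  have CC: "2 * 4 ^ L * 3 ^ Suc k * (1 + c) ^ (L + Suc k) * K = 3 * (1 + c) * C"
    by (simp add: C_def)
  \<comment> \<open>As d^2 <= c, the two summands of the derivative together contribute 1 + 2 c <= 3
    (1 + c), the factor gained per step.\<close>
  have le: "C + \<bar>2 * d\<^sup>2\<bar> * (\<integral>v. C \<partial>unit_measure) \<le> 3 * (1 + c) * C"
  proof -
    have "d\<^sup>2 * C \<le> c * C" using Suc.prems(2) C by (rule mult_right_mono)
    moreover have "0 \<le> c * C" using c C by simp
    ultimately show ?thesis using C unfolding unit_integral_const by (simp add: algebra_simps)
  qed
  show ?case
    unfolding CC
  proof (rule pol_bd_SucI)
    show "\<bar>sqrt_avg c d f y\<bar> \<le> 3 * (1 + c) * C * (1 + y ^ L)" if y: "0 \<le> y" for y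
    proof (rule order_trans[OF sqrt_avg_bound[OF Suc.prems y] mult_right_mono])
      have "1 * (2 * 4 ^ L * (1 + c) ^ L * K) \<le> (3 ^ Suc k * (1 + c) ^ Suc k) * (2 * 4 ^ L * (1 + c) ^ L * K)"
        using c K unfolding power_mult_distrib[symmetric] by (intro mult_right_mono one_le_power) auto
      also have "\<dots> = 3 * (1 + c) * C"
        by (simp add: C_def power_add)
      finally show "2 * 4 ^ L * (1 + c) ^ L * K \<le> 3 * (1 + c) * C" by simp
    qed (use y in auto)
    show "(sqrt_avg c d f has_real_derivative (sqrt_avg c d (deriv_Rp f) y +
       2 * d\<^sup>2 * (\<integral>v. sqrt_avg c (d * v) (deriv_Rp (deriv_Rp f)) y \<partial>unit_measure))) (at y within {0..})"
      if "0 \<le> y" for y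
      by (rule sqrt_avg_deriv[OF pol_bd_le[OF Suc.prems(1)] Suc.prems(2) that]) simp
    show "pol_bd k L (3 * (1 + c) * C) (\<lambda>y. sqrt_avg c d (deriv_Rp f) y +
       2 * d\<^sup>2 * (\<integral>v. sqrt_avg c (d * v) (deriv_Rp (deriv_Rp f)) y \<partial>unit_measure))"
    proof (rule pol_bd_mono[OF pol_bd_add[OF _ pol_bd_cmult] le])
      show "pol_bd k L C (sqrt_avg c d (deriv_Rp f))"
        unfolding C_def by (rule Suc.IH[OF pol_bd_Suc_le[OF f1] Suc.prems(2)])
      show "pol_bd k L (\<integral>v. C \<partial>unit_measure)
        (\<lambda>y. \<integral>v. sqrt_avg c (d * v) (deriv_Rp (deriv_Rp f)) y \<partial>unit_measure)"
      proof (rule pol_bd_integral)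
        show "pol_bd k L C (sqrt_avg c (d * v) (deriv_Rp (deriv_Rp f)))"
          if "v \<in> space unit_measure" for v
          unfolding C_def using that
          by (intro Suc.IH[OF f2] scaled_param_le[OF Suc.prems(2)]) (simp add: space_restrict_space)
      qed (auto intro!: unit_integrable unit_measurable sqrt_avg_continuous_param
          pol_bd_continuous[OF f2] Suc.prems(2))
    qed
  qed
qed

section \<open>Taylor remainders of the flow and of the symmetric averages\<close>

lemma deriv_Rp_cong:
  assumes "\<And>x. 0 \<le> x \<Longrightarrow> f x = g x" "0 \<le> y"
  shows "deriv_Rp f y = deriv_Rp g y"
proof -
  have "(f has_vector_derivative D) (at y within {0..}) \<longleftrightarrow>
      (g has_vector_derivative D) (at y within {0..})" for D
    using has_real_derivative_cong_Rp[of f D y g] has_real_derivative_cong_Rp[of g D y f] assms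
    by (metis has_real_derivative_iff_has_vector_derivative)
  then show ?thesis
    by (simp add: deriv_Rp_def vector_derivative_def)
qed

lemma deriv_Rp_lincomb:
  assumes "pol_bd (Suc k) L K f" "pol_bd (Suc k') L' K' g" "0 \<le> y"
  shows "deriv_Rp (\<lambda>y. f y + c * g y) y = deriv_Rp f y + c * deriv_Rp g y"
  by (intro deriv_Rp_eqI DERIV_add DERIV_cmult pol_bd_deriv_Rp(2)[OF assms(1)]
      pol_bd_deriv_Rp(2)[OF assms(2)] assms(3))

definition drift_gen :: "real \<Rightarrow> real \<Rightarrow> (real \<Rightarrow> real) \<Rightarrow> real \<Rightarrow> real" where
  "drift_gen b \<kappa> f y = (\<kappa> - b * y) * deriv_Rp f y"

definition diff_gen :: "(real \<Rightarrow> real) \<Rightarrow> real \<Rightarrow> real" where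
  "diff_gen f y = 2 * deriv_Rp f y + 4 * (y * deriv_Rp (deriv_Rp f) y)"

lemma pol_bd_drift_gen:
  assumes "pol_bd (Suc k) L K f"
  shows "pol_bd k (Suc L) ((2 * \<bar>\<kappa>\<bar> + 2 * \<bar>b\<bar> * (1 + real k)) * K) (drift_gen b \<kappa> f)"
proof -
  note d = pol_bd_deriv_Rp(1)[OF assms]
  have "pol_bd k (Suc L) (\<bar>\<kappa>\<bar> * (2 * K) + \<bar>- b\<bar> * (2 * (1 + real k) * K))
      (\<lambda>y. \<kappa> * deriv_Rp f y + (- b) * (y * deriv_Rp f y))"
    by (intro pol_bd_add pol_bd_cmult pol_bd_mult_id pol_bd_degree_mono[OF d] d) simp
  also have "(\<lambda>y. \<kappa> * deriv_Rp f y + (- b) * (y * deriv_Rp f y)) = drift_gen b \<kappa> f"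
    by (simp add: drift_gen_def fun_eq_iff algebra_simps)
  also have "\<bar>\<kappa>\<bar> * (2 * K) + \<bar>- b\<bar> * (2 * (1 + real k) * K) = (2 * \<bar>\<kappa>\<bar> + 2 * \<bar>b\<bar> * (1 + real k)) * K"
    by (simp add: algebra_simps)
  finally show ?thesis .
qed

lemma pol_bd_diff_gen:
  assumes "pol_bd (Suc (Suc k)) L K f"
  shows "pol_bd k (Suc L) ((4 + 8 * (1 + real k)) * K) (diff_gen f)"
proof -
  note d = pol_bd_deriv_Rp(1)[OF assms]
  note dd = pol_bd_deriv_Rp(1)[OF d]
  have "pol_bd k (Suc L) (\<bar>2\<bar> * (2 * K) + \<bar>4\<bar> * (2 * (1 + real k) * K))
      (\<lambda>y. 2 * deriv_Rp f y + 4 * (y * deriv_Rp (deriv_Rp f) y))"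
    by (intro pol_bd_add pol_bd_cmult pol_bd_mult_id pol_bd_degree_mono[OF pol_bd_Suc_le[OF d]] dd) simp
  also have "\<bar>2\<bar> * (2 * K) + \<bar>4\<bar> * (2 * (1 + real k) * K) = (4 + 8 * (1 + real k)) * K"
    by (simp add: algebra_simps)
  finally show ?thesis
    unfolding diff_gen_def[abs_def] .
qed

section \<open>The deterministic flow and its Taylor remainder in time\<close>

definition cir_flow :: "real \<Rightarrow> real \<Rightarrow> real \<Rightarrow> real \<Rightarrow> real" where
  "cir_flow b \<kappa> \<tau> y = exp (- b * \<tau>) * y + psi b \<tau> * \<kappa>"

lemma psi_has_derivative:
  "(psi b has_real_derivative exp (- b * \<tau>)) (at \<tau> within S)"
  unfolding psi_def[abs_def]
  by (cases "b = 0") (auto intro!: derivative_eq_intros)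

lemma psi_eq: "exp (- b * \<tau>) = 1 - b * psi b \<tau>"
  by (simp add: psi_def)

lemma psi_bounds:
  assumes "0 \<le> \<tau>"
  shows "0 \<le> psi b \<tau>" "psi b \<tau> \<le> \<tau> * exp (\<bar>b\<bar> * \<tau>)"
proof -
  have 1: "1 - exp (- x) \<le> x" "1 - exp (- x) \<ge> 0 \<longleftrightarrow> 0 \<le> x" for x :: real
    using exp_ge_add_one_self[of "- x"] by simp_all
  show "0 \<le> psi b \<tau>"
    using assms 1(2)[of "b * \<tau>"]
    by (cases "b = 0"; cases "b > 0") (auto simp: psi_def zero_le_divide_iff mult_nonpos_nonneg)
  show "psi b \<tau> \<le> \<tau> * exp (\<bar>b\<bar> * \<tau>)"
  proof (cases "b > 0")
    case True
    then have "psi b \<tau> \<le> \<tau>"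
      using 1(1)[of "b * \<tau>"] by (simp add: psi_def divide_le_eq mult.commute)
    also have "\<dots> \<le> \<tau> * exp (\<bar>b\<bar> * \<tau>)"
      using assms mult_left_mono[of 1 "exp (\<bar>b\<bar> * \<tau>)" \<tau>] by simp
    finally show ?thesis .
  next
    case False
    \<comment> \<open>For b <= 0 the elementary inequality is used at -b \<tau> and multiplied by
      exp(-b \<tau>); dividing by -b gives the bound when b < 0, and b = 0 is immediate.\<close>
    have "exp (- b * \<tau>) - 1 \<le> - b * \<tau> * exp (- b * \<tau>)"
    proof -
      have "exp (- b * \<tau>) * (1 - exp (b * \<tau>)) \<le> exp (- b * \<tau>) * (- b * \<tau>)"
        using 1(1)[of "- b * \<tau>"] by (intro mult_left_mono) auto
      moreover have "exp (- b * \<tau>) * exp (b * \<tau>) = 1"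
        by (simp flip: exp_add)
      ultimately show ?thesis by (simp add: algebra_simps)
    qed
    then show ?thesis
      using False by (auto simp: psi_def divide_le_eq mult_ac)
  qed
qed

lemma cir_flow_nonneg:
  assumes "0 \<le> \<kappa>" "0 \<le> \<tau>" "0 \<le> y"
  shows "0 \<le> cir_flow b \<kappa> \<tau> y"
  using assms psi_bounds(1)[of \<tau> b] by (simp add: cir_flow_def)

text \<open>One constant, uniform up to time \<open>T\<close>, dominates both the slope of the
  affine flow and its value relative to 1 + y.\<close>

definition flow_growth :: "real \<Rightarrow> real \<Rightarrow> real \<Rightarrow> real" where
  "flow_growth b \<kappa> T = exp (\<bar>b\<bar> * T) * (1 + T * \<kappa>)"

lemma flow_growth_bounds:
  assumes "0 \<le> \<kappa>" "0 \<le> \<tau>" "\<tau> \<le> T"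
  shows "1 \<le> flow_growth b \<kappa> T" "exp (- b * \<tau>) \<le> flow_growth b \<kappa> T"
    and "0 \<le> y \<Longrightarrow> cir_flow b \<kappa> \<tau> y \<le> flow_growth b \<kappa> T * (1 + y)"
proof -
  have e1: "1 \<le> exp (\<bar>b\<bar> * T)" and k: "0 \<le> T * \<kappa>" using assms by auto
  have "- b * \<tau> \<le> \<bar>b\<bar> * \<tau>" using assms by (intro mult_right_mono) auto
  also have "\<dots> \<le> \<bar>b\<bar> * T" using assms by (intro mult_left_mono) auto
  finally have e: "exp (- b * \<tau>) \<le> exp (\<bar>b\<bar> * T)" by simp
  have ps: "psi b \<tau> \<le> T * exp (\<bar>b\<bar> * T)"
    using assms by (intro order_trans[OF psi_bounds(2)] mult_mono) (auto intro: mult_left_mono)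
  have le: "exp (\<bar>b\<bar> * T) * 1 \<le> flow_growth b \<kappa> T"
    unfolding flow_growth_def using k by (intro mult_left_mono) auto
  then show "1 \<le> flow_growth b \<kappa> T" "exp (- b * \<tau>) \<le> flow_growth b \<kappa> T"
    using order_trans[OF e1] order_trans[OF e] by auto
  show "cir_flow b \<kappa> \<tau> y \<le> flow_growth b \<kappa> T * (1 + y)" if y: "0 \<le> y"
  proof -
    have "cir_flow b \<kappa> \<tau> y \<le> exp (\<bar>b\<bar> * T) * y + T * exp (\<bar>b\<bar> * T) * \<kappa>"
      unfolding cir_flow_def using e ps y assms by (intro add_mono mult_right_mono) auto
    \<comment> \<open>The added nonnegative term completes the sum to the product of
      \<open>flow_growth\<close> and 1 + y.\<close>
    also have "\<dots> \<le> exp (\<bar>b\<bar> * T) * y + T * exp (\<bar>b\<bar> * T) * \<kappa> + exp (\<bar>b\<bar> * T) * (1 + T * \<kappa> * y)"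
      using k y by simp
    also have "\<dots> = flow_growth b \<kappa> T * (1 + y)"
      by (simp add: flow_growth_def algebra_simps)
    finally show ?thesis .
  qed
qed

text \<open>The flow is affine in \<open>y\<close>, so each derivative yields just one factor exp(-b
  \<tau>), at most \<open>flow_growth\<close>. The growth of \<open>f\<close> along the flow is
  handled by \<open>growth_le\<close>.\<close>

lemma pol_bd_flow:
  assumes "pol_bd k L K f" "0 \<le> \<kappa>" "0 \<le> \<tau>" "\<tau> \<le> T"
  shows "pol_bd k L (2 * (2 * flow_growth b \<kappa> T) ^ L * flow_growth b \<kappa> T ^ k * K)
    (\<lambda>y. f (cir_flow b \<kappa> \<tau> y))"
  using assms(1)
proof (induction k arbitrary: f)
  note g = flow_growth_bounds[OF assms(2-4), where b = b]
  note f0 = cir_flow_nonneg[OF assms(2,3), of _ b]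
  have *: "\<bar>f (cir_flow b \<kappa> \<tau> y)\<bar> \<le> 2 * (2 * flow_growth b \<kappa> T) ^ L * flow_growth b \<kappa> T ^ k * K * (1 + y ^ L)"
    if "pol_bd j L K f" "0 \<le> y" for j k f y
  proof -
    have "\<bar>f (cir_flow b \<kappa> \<tau> y)\<bar> \<le> K * (1 + cir_flow b \<kappa> \<tau> y ^ L)"
      by (rule pol_bd_bound[OF that(1) f0[OF that(2)]])
    also have "\<dots> \<le> K * (2 * (2 * flow_growth b \<kappa> T) ^ L * (1 + y ^ L))"
      by (intro mult_left_mono growth_le[OF f0 g(3)] g(1) that(2) pol_bd_nonneg[OF that(1)])
    also have "\<dots> = 1 * (2 * (2 * flow_growth b \<kappa> T) ^ L * K * (1 + y ^ L))"
      by (simp only: mult_ac mult_1)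
    also have "\<dots> \<le> flow_growth b \<kappa> T ^ k * (2 * (2 * flow_growth b \<kappa> T) ^ L * K * (1 + y ^ L))"
      using g(1) that(2) pol_bd_nonneg[OF that(1)]
      by (intro mult_right_mono one_le_power mult_nonneg_nonneg) auto
    finally show ?thesis by (simp only: mult_ac)
  qed
  {
    case (0 f)
    have "continuous_on {0..} (\<lambda>y. f (cir_flow b \<kappa> \<tau> y))"
      using f0 by (intro continuous_on_Rp_compose[OF pol_bd_continuous[OF 0]])
        (auto simp: cir_flow_def intro!: continuous_intros)
    then show ?case using *[OF 0, of _ 0] by simp
  next
    case (Suc k f)
    define C where "C = 2 * (2 * flow_growth b \<kappa> T) ^ L * flow_growth b \<kappa> T ^ k * K"
    have C: "0 \<le> C" using g(1) pol_bd_nonneg[OF Suc.prems] by (simp add: C_def)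
    show ?case
    proof (rule pol_bd_SucI)
      show "((\<lambda>y. f (cir_flow b \<kappa> \<tau> y)) has_real_derivative
          exp (- b * \<tau>) * deriv_Rp f (cir_flow b \<kappa> \<tau> y)) (at y within {0..})" if "0 \<le> y" for y
        unfolding mult.commute[of "exp _"]
      proof (rule has_real_derivative_chain_Rp[OF pol_bd_deriv_Rp(2)[OF Suc.prems]])
        have "((\<lambda>y. exp (- b * \<tau>) * y + psi b \<tau> * \<kappa>) has_real_derivative exp (- b * \<tau>) * 1 + 0) (at y within {0..})"
          by (intro DERIV_add DERIV_cmult DERIV_ident DERIV_const)
        then show "(cir_flow b \<kappa> \<tau> has_real_derivative exp (- b * \<tau>)) (at y within {0..})"
          by (simp add: cir_flow_def[abs_def])
      qed (use that f0 in auto)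
      have bd: "pol_bd k L (\<bar>exp (- b * \<tau>)\<bar> * C) (\<lambda>y. exp (- b * \<tau>) * deriv_Rp f (cir_flow b \<kappa> \<tau> y))"
        unfolding C_def by (intro pol_bd_cmult Suc.IH pol_bd_deriv_Rp(1)[OF Suc.prems])
      have le: "\<bar>exp (- b * \<tau>)\<bar> * C \<le> flow_growth b \<kappa> T * C"
        using g(2) C by (intro mult_right_mono) auto
      have eq: "flow_growth b \<kappa> T * C = 2 * (2 * flow_growth b \<kappa> T) ^ L * flow_growth b \<kappa> T ^ Suc k * K"
        by (simp add: C_def)
      show "pol_bd k L (2 * (2 * flow_growth b \<kappa> T) ^ L * flow_growth b \<kappa> T ^ Suc k * K)
          (\<lambda>y. exp (- b * \<tau>) * deriv_Rp f (cir_flow b \<kappa> \<tau> y))"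
        by (rule pol_bd_mono[OF bd le[unfolded eq]])
    qed (rule *[OF Suc.prems])
  }
qed

definition flow_rem :: "real \<Rightarrow> real \<Rightarrow> nat \<Rightarrow> real \<Rightarrow> (real \<Rightarrow> real) \<Rightarrow> real \<Rightarrow> real" where
  "flow_rem b \<kappa> n \<tau> f y =
     f (cir_flow b \<kappa> \<tau> y) - (\<Sum>j<n. \<tau> ^ j / fact j * (drift_gen b \<kappa> ^^ j) f y)"

lemma power_fact_has_derivative:
  "((\<lambda>\<theta>. (\<theta> * \<tau>) ^ Suc j / fact (Suc j) * c) has_real_derivative
     \<tau> * ((\<theta> * \<tau>) ^ j / fact j * c)) (at \<theta> within S)"
proof -
  have p: "((\<lambda>\<theta>. (\<theta> * \<tau>) ^ Suc j) has_real_derivative (1 + real j) * (\<tau> * (\<theta> * \<tau>) ^ j)) (at \<theta> within S)"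
    by (rule DERIV_power_Suc, rule DERIV_cong[OF DERIV_cmult_right[OF DERIV_ident]]) simp
  have F: "fact (Suc j) = (1 + real j) * fact j"
    by (metis fact_Suc of_nat_Suc)
  have c: "n * (\<tau> * q) * (c / (n * F)) = \<tau> * (q / F * c)" if "n \<noteq> 0" for n q F :: real
    using that by simp
  have "1 + real j \<noteq> 0" by linarith
  from c[OF this, of "(\<theta> * \<tau>) ^ j" "fact j"] show ?thesis
    by (intro DERIV_cong[OF DERIV_cmult_right[OF DERIV_cdivide[OF p]]])
      (simp only: F times_divide_eq_left times_divide_eq_right)
qed

lemma cir_flow_time_derivative:
  "((\<lambda>\<theta>. cir_flow b \<kappa> (\<theta> * \<tau>) y) has_real_derivative \<tau> * (\<kappa> - b * cir_flow b \<kappa> (\<theta> * \<tau>) y))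
    (at \<theta> within S)"
proof -
  have "((\<lambda>\<theta>. psi b (\<theta> * \<tau>)) has_real_derivative exp (- b * (\<theta> * \<tau>)) * \<tau>) (at \<theta> within S)"
    by (rule DERIV_chain2[OF psi_has_derivative]) (auto intro!: derivative_eq_intros)
  then have "((\<lambda>\<theta>. cir_flow b \<kappa> (\<theta> * \<tau>) y) has_real_derivative
      exp (- b * (\<theta> * \<tau>)) * (- b * \<tau>) * y + exp (- b * (\<theta> * \<tau>)) * \<tau> * \<kappa>) (at \<theta> within S)"
    unfolding cir_flow_def by (auto intro!: derivative_eq_intros)
  moreover have "exp (- b * (\<theta> * \<tau>)) * (- b * \<tau>) * y + exp (- b * (\<theta> * \<tau>)) * \<tau> * \<kappa> =
      \<tau> * (\<kappa> - b * cir_flow b \<kappa> (\<theta> * \<tau>) y)"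
    unfolding cir_flow_def psi_eq by (simp add: algebra_simps)
  ultimately show ?thesis by simp
qed

lemma cir_flow_0 [simp]: "cir_flow b \<kappa> 0 y = y"
  by (simp add: cir_flow_def psi_def)

lemma flow_rem_continuous:
  assumes "continuous_on {0..} f" "0 \<le> \<kappa>" "0 \<le> \<tau>" "0 \<le> y"
  shows "continuous_on {0..1} (\<lambda>\<theta>. flow_rem b \<kappa> n (\<theta> * \<tau>) f y)"
proof -
  have "continuous_on {0..1} (\<lambda>\<theta>. cir_flow b \<kappa> (\<theta> * \<tau>) y)"
    using cir_flow_time_derivative[of b \<kappa> \<tau> y] by (intro DERIV_continuous_on)
  then show ?thesis
    unfolding flow_rem_def using assms
    by (intro continuous_intros continuous_on_Rp_compose[OF assms(1)] cir_flow_nonneg) auto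
qed

text \<open>Along the flow, d/d\<theta> f = \<tau> (B f), and the Taylor sum differentiates to that
  of B f with one term fewer. Scaling time by \<theta> puts the integral on the unit
  interval.\<close>

lemma flow_rem_Suc:
  assumes f: "pol_bd (Suc k) L K f" and "0 \<le> \<kappa>" "0 \<le> \<tau>" "0 \<le> y"
  shows "flow_rem b \<kappa> (Suc n) \<tau> f y =
    (\<integral>\<theta>. \<tau> * flow_rem b \<kappa> n (\<theta> * \<tau>) (drift_gen b \<kappa> f) y \<partial>unit_measure)"
proof -
  define a where "a j = (drift_gen b \<kappa> ^^ Suc j) f y" for j
  \<comment> \<open>The term of order 0 is omitted as it is constant in \<theta>; it reappears as
    \<open>F 0\<close>, which equals \<open>f y\<close>.\<close>
  define F where "F \<theta> = f (cir_flow b \<kappa> (\<theta> * \<tau>) y) - (\<Sum>j<n. (\<theta> * \<tau>) ^ Suc j / fact (Suc j) * a j)" for \<theta>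
  have "(\<integral>\<theta>. \<tau> * flow_rem b \<kappa> n (\<theta> * \<tau>) (drift_gen b \<kappa> f) y \<partial>unit_measure) = F 1 - F 0"
  proof (rule unit_integral_FTC)
    show "continuous_on {0..1} (\<lambda>\<theta>. \<tau> * flow_rem b \<kappa> n (\<theta> * \<tau>) (drift_gen b \<kappa> f) y)"
      using assms pol_bd_continuous[OF pol_bd_drift_gen[OF f]]
      by (intro continuous_intros flow_rem_continuous)
    fix \<theta> :: real assume th: "\<theta> \<in> {0..1}"
    have nonneg: "0 \<le> cir_flow b \<kappa> (x * \<tau>) y" if "x \<in> {0..1}" for x
      using that assms(2-4) by (intro cir_flow_nonneg mult_nonneg_nonneg) auto
    have "((\<lambda>\<theta>. f (cir_flow b \<kappa> (\<theta> * \<tau>) y)) has_real_derivative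
        deriv_Rp f (cir_flow b \<kappa> (\<theta> * \<tau>) y) * (\<tau> * (\<kappa> - b * cir_flow b \<kappa> (\<theta> * \<tau>) y))) (at \<theta> within {0..1})"
      by (rule has_real_derivative_chain_Rp[OF pol_bd_deriv_Rp(2)[OF f] cir_flow_time_derivative th nonneg])
    moreover have "((\<lambda>\<theta>. (\<theta> * \<tau>) ^ Suc j / fact (Suc j) * a j) has_real_derivative
        \<tau> * ((\<theta> * \<tau>) ^ j / fact j * a j)) (at \<theta> within {0..1})" for j
      by (rule power_fact_has_derivative)
    ultimately have "(F has_real_derivative
        deriv_Rp f (cir_flow b \<kappa> (\<theta> * \<tau>) y) * (\<tau> * (\<kappa> - b * cir_flow b \<kappa> (\<theta> * \<tau>) y))
        - (\<Sum>j<n. \<tau> * ((\<theta> * \<tau>) ^ j / fact j * a j))) (at \<theta> within {0..1})"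
      unfolding F_def[abs_def] by (intro DERIV_diff DERIV_sum)
    moreover have "deriv_Rp f (cir_flow b \<kappa> (\<theta> * \<tau>) y) * (\<tau> * (\<kappa> - b * cir_flow b \<kappa> (\<theta> * \<tau>) y))
        - (\<Sum>j<n. \<tau> * ((\<theta> * \<tau>) ^ j / fact j * a j)) = \<tau> * flow_rem b \<kappa> n (\<theta> * \<tau>) (drift_gen b \<kappa> f) y"
      unfolding flow_rem_def a_def funpow_Suc_right o_def sum_distrib_left[symmetric]
      by (simp add: drift_gen_def algebra_simps)
    ultimately show "(F has_real_derivative \<tau> * flow_rem b \<kappa> n (\<theta> * \<tau>) (drift_gen b \<kappa> f) y) (at \<theta> within {0..1})"
      by simp
  qed
  also have "\<dots> = flow_rem b \<kappa> (Suc n) \<tau> f y"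
    unfolding F_def flow_rem_def a_def sum.lessThan_Suc_shift by simp
  finally show ?thesis by simp
qed

text \<open>Induction on \<open>n\<close> through \<open>flow_rem_Suc\<close>. \<open>L\<close> is
  generalised since B raises the degree by one, and the integrand is bounded using \<tau> (\<theta>
  \<tau>)^n <= \<tau>^(n+1).\<close>

lemma pol_bd_flow_rem:
  assumes "0 \<le> \<kappa>" "0 \<le> T"
  shows "\<exists>C\<ge>0. \<forall>\<tau>\<in>{0..T}. \<forall>f K. pol_bd (k + n) L K f \<longrightarrow>
     pol_bd k (L + n) (C * \<tau> ^ n * K) (flow_rem b \<kappa> n \<tau> f)"
proof (induction n arbitrary: L)
  case 0
  have "0 \<le> 2 * (2 * flow_growth b \<kappa> T) ^ L * flow_growth b \<kappa> T ^ k"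
    using flow_growth_bounds(1)[OF assms(1) order_refl assms(2), of b] by simp
  moreover have "flow_rem b \<kappa> 0 \<tau> f = (\<lambda>y. f (cir_flow b \<kappa> \<tau> y))" for \<tau> f
    by (simp add: flow_rem_def fun_eq_iff)
  ultimately show ?case
    using pol_bd_flow[OF _ assms(1), where T = T] by (auto intro!: exI[of _ "2 * (2 * flow_growth b \<kappa> T) ^ L * flow_growth b \<kappa> T ^ k"])
next
  case (Suc n)
  obtain C where C: "0 \<le> C" and IH: "\<And>\<tau> f K. \<tau> \<in> {0..T} \<Longrightarrow> pol_bd (k + n) (Suc L) K f \<Longrightarrow>
     pol_bd k (Suc L + n) (C * \<tau> ^ n * K) (flow_rem b \<kappa> n \<tau> f)"
    using Suc[of "Suc L"] by blast
  define B where "B = 2 * \<bar>\<kappa>\<bar> + 2 * \<bar>b\<bar> * (1 + real (k + n))"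
  have B: "0 \<le> B" by (simp add: B_def)
  have "pol_bd k (L + Suc n) (C * B * \<tau> ^ Suc n * K) (flow_rem b \<kappa> (Suc n) \<tau> f)"
    if t: "\<tau> \<in> {0..T}" and f: "pol_bd (k + Suc n) L K f" for \<tau> f K
  proof -
    have f': "pol_bd (Suc (k + n)) L K f" using f by (simp del: pol_bd.simps)
    note Bf = pol_bd_drift_gen[OF f', of \<kappa> b, folded B_def]
    have K: "0 \<le> K" using pol_bd_nonneg[OF f] .
    have "pol_bd k (Suc L + n) (\<integral>\<theta>. C * B * \<tau> ^ Suc n * K \<partial>unit_measure)
       (\<lambda>y. \<integral>\<theta>. \<tau> * flow_rem b \<kappa> n (\<theta> * \<tau>) (drift_gen b \<kappa> f) y \<partial>unit_measure)"
    proof (rule pol_bd_integral)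
      fix \<theta> assume "\<theta> \<in> space unit_measure"
      then have th: "\<theta> \<in> {0..1}" by (simp add: space_restrict_space)
      have tt: "0 \<le> \<theta> * \<tau>" "\<theta> * \<tau> \<le> \<tau>" using th t by (auto simp: mult_left_le_one_le)
      have bd: "pol_bd k (Suc L + n) (\<bar>\<tau>\<bar> * (C * (\<theta> * \<tau>) ^ n * (B * K)))
         (\<lambda>y. \<tau> * flow_rem b \<kappa> n (\<theta> * \<tau>) (drift_gen b \<kappa> f) y)"
        using tt t by (intro pol_bd_cmult IH Bf) auto
      have le: "\<bar>\<tau>\<bar> * (C * (\<theta> * \<tau>) ^ n * (B * K)) \<le> \<bar>\<tau>\<bar> * (C * \<tau> ^ n * (B * K))"
        using tt C B K by (intro mult_left_mono mult_right_mono power_mono) auto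
      have eq: "\<bar>\<tau>\<bar> * (C * \<tau> ^ n * (B * K)) = C * B * \<tau> ^ Suc n * K"
        using t by simp
      show "pol_bd k (Suc L + n) (C * B * \<tau> ^ Suc n * K)
         (\<lambda>y. \<tau> * flow_rem b \<kappa> n (\<theta> * \<tau>) (drift_gen b \<kappa> f) y)"
        by (rule pol_bd_mono[OF bd le[unfolded eq]])
    next
      fix y :: real assume y: "0 \<le> y"
      show "(\<lambda>\<theta>. \<tau> * flow_rem b \<kappa> n (\<theta> * \<tau>) (drift_gen b \<kappa> f) y) \<in> borel_measurable unit_measure"
        using t y by (intro unit_measurable continuous_intros flow_rem_continuous
            pol_bd_continuous[OF Bf] assms(1)) auto
    qed (intro unit_integrable continuous_intros)
    then have "pol_bd k (L + Suc n) (C * B * \<tau> ^ Suc n * K)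
       (\<lambda>y. \<integral>\<theta>. \<tau> * flow_rem b \<kappa> n (\<theta> * \<tau>) (drift_gen b \<kappa> f) y \<partial>unit_measure)"
      unfolding unit_integral_const by simp
    then show ?thesis
      by (rule pol_bd_cong) (use flow_rem_Suc[OF f' assms(1)] t in auto)
  qed
  then show ?case
    using C B by (intro exI[of _ "C * B"]) auto
qed

section \<open>The Taylor remainder of the symmetric average\<close>

definition heat_avg :: "real \<Rightarrow> (real \<Rightarrow> real) \<Rightarrow> real \<Rightarrow> real" where
  "heat_avg u = sqrt_avg (u\<^sup>2) u"

lemma heat_avg_eq:
  assumes "0 \<le> y"
  shows "heat_avg u f y = (f ((sqrt y + u)\<^sup>2) + f ((sqrt y - u)\<^sup>2)) / 2"
  using assms by (simp add: heat_avg_def sqrt_avg_def power2_sum power2_diff algebra_simps)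

definition heat_rem :: "nat \<Rightarrow> real \<Rightarrow> (real \<Rightarrow> real) \<Rightarrow> real \<Rightarrow> real" where
  "heat_rem n u f y = heat_avg u f y - (\<Sum>j<n. u ^ (2 * j) / fact (2 * j) * (diff_gen ^^ j) f y)"

lemma heat_rem_continuous:
  assumes "continuous_on {0..} f" "0 \<le> y"
  shows "continuous_on UNIV (\<lambda>u. heat_rem n u f y)"
  unfolding heat_rem_def heat_avg_eq[OF assms(2)]
  by (intro continuous_intros continuous_on_Rp_compose[OF assms(1)]) auto

text \<open>Integration by parts: (1 - x) G1 + G is a primitive of (1 - x) G2, and the boundary term
  at 0 disappears because G1 vanishes there.\<close>

lemma unit_integral_Taylor2:
  assumes "\<And>x. x \<in> {0..1} \<Longrightarrow> (G has_real_derivative G1 x) (at x within {0..1})"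
    and "\<And>x. x \<in> {0..1} \<Longrightarrow> (G1 has_real_derivative G2 x) (at x within {0..1})"
    and "continuous_on {0..1} G2" "G1 0 = 0"
  shows "(\<integral>x. (1 - x) * G2 x \<partial>unit_measure) = G 1 - G 0"
proof -
  have "(\<integral>x. (1 - x) * G2 x \<partial>unit_measure) =
      ((1 - 1) * G1 1 + G 1) - ((1 - 0) * G1 0 + G 0)"
  proof (rule unit_integral_FTC)
    show "((\<lambda>x. (1 - x) * G1 x + G x) has_real_derivative (1 - x) * G2 x) (at x within {0..1})"
      if "x \<in> {0..1}" for x
      by (rule derivative_eq_intros assms(1)[OF that] assms(2)[OF that] refl)+ simp
  qed (intro continuous_intros assms(3))
  then show ?thesis using assms(4) by simp
qed

text \<open>In the variable \<open>x = sqrt y\<close> the operator \<open>diff_gen\<close> becomes the second derivative of the even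
  function \<open>f (x\<^sup>2)\<close>, so \<open>heat_rem\<close> is an ordinary Taylor remainder.\<close>

lemma heat_rem_Suc:
  assumes f: "pol_bd (Suc (Suc k)) L K f" and y: "0 \<le> y"
  shows "heat_rem (Suc n) u f y =
    (\<integral>\<theta>. (1 - \<theta>) * (u\<^sup>2 * heat_rem n (\<theta> * u) (diff_gen f) y) \<partial>unit_measure)"
proof -
  note f1 = pol_bd_deriv_Rp(1)[OF f]
  define x where "x = sqrt y"
  define h h1 h2 where "h z = f (z\<^sup>2)" and "h1 z = deriv_Rp f (z\<^sup>2) * (2 * z)"
    and "h2 z = diff_gen f (z\<^sup>2)" for z
  have sq: "((\<lambda>z. z\<^sup>2) has_real_derivative 2 * z) (at z within S)" for z :: real and S
    by (auto intro!: derivative_eq_intros)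
  have h: "(h has_real_derivative h1 z) (at z)" for z
    unfolding h_def h1_def by (rule has_real_derivative_chain_Rp[OF pol_bd_deriv_Rp(2)[OF f] sq]) auto
  have "((\<lambda>z. deriv_Rp f (z\<^sup>2)) has_real_derivative deriv_Rp (deriv_Rp f) (z\<^sup>2) * (2 * z)) (at z)" for z
    by (rule has_real_derivative_chain_Rp[OF pol_bd_deriv_Rp(2)[OF f1] sq]) auto
  then have h1: "(h1 has_real_derivative h2 z) (at z)" for z
    unfolding h1_def[abs_def] h2_def diff_gen_def
    by (auto intro!: derivative_eq_intros simp: power2_eq_square algebra_simps)
  define a where "a j = (diff_gen ^^ Suc j) f y" for j
  define G where "G \<theta> = (h (x + \<theta> * u) + h (x - \<theta> * u)) / 2
      - (\<Sum>j<n. (\<theta> * u) ^ (2 * j + 2) / fact (2 * j + 2) * a j)" for \<theta>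
  \<comment> \<open>At \<theta> = 0 the two values of \<open>h1\<close> cancel and the odd powers
    vanish, so \<open>G1\<close> is 0 there: symmetrisation removes the first-order term.\<close>
  define G1 where "G1 \<theta> = u * (h1 (x + \<theta> * u) - h1 (x - \<theta> * u)) / 2
      - (\<Sum>j<n. u * (\<theta> * u) ^ (2 * j + 1) / fact (2 * j + 1) * a j)" for \<theta>
  have G2: "u\<^sup>2 * heat_rem n (\<theta> * u) (diff_gen f) y = u\<^sup>2 * (h2 (x + \<theta> * u) + h2 (x - \<theta> * u)) / 2
      - (\<Sum>j<n. u\<^sup>2 * (\<theta> * u) ^ (2 * j) / fact (2 * j) * a j)" for \<theta>
    unfolding heat_rem_def heat_avg_eq[OF y] h2_def x_def a_def
    by (simp add: funpow_swap1 sum_distrib_left algebra_simps)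
  have shift: "((\<lambda>\<theta>. g (x + \<theta> * v)) has_real_derivative g' (x + \<theta> * v) * v) (at \<theta> within S)"
    if "\<And>z. (g has_real_derivative g' z) (at z)" for g g' v \<theta> S
    by (rule DERIV_chain2[OF that]) (auto intro!: derivative_eq_intros)
  have shift_minus: "((\<lambda>\<theta>. g (x - \<theta> * u)) has_real_derivative - (g' (x - \<theta> * u) * u)) (at \<theta> within S)"
    if "\<And>z. (g has_real_derivative g' z) (at z)" for g g' \<theta> S
    using shift[OF that, of "- u"] by simp
  have "(\<integral>\<theta>. (1 - \<theta>) * (u\<^sup>2 * heat_rem n (\<theta> * u) (diff_gen f) y) \<partial>unit_measure) = G 1 - G 0"
  proof (rule unit_integral_Taylor2)
    fix \<theta> :: real
    have p1: "((\<lambda>\<theta>. (\<theta> * u) ^ (2 * j + 2) / fact (2 * j + 2) * a j) has_real_derivative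
        u * (\<theta> * u) ^ (2 * j + 1) / fact (2 * j + 1) * a j) (at \<theta> within {0..1})" for j
      using power_fact_has_derivative[of u "2 * j + 1" "a j" \<theta> "{0..1}"]
      by (simp add: mult.assoc del: fact_Suc power_Suc)
    show "(G has_real_derivative G1 \<theta>) (at \<theta> within {0..1})"
      unfolding G_def[abs_def] G1_def
      by (intro DERIV_diff DERIV_sum p1,
          rule DERIV_cong[OF DERIV_cdivide[OF DERIV_add[OF shift[OF h] shift_minus[OF h]]]])
        (simp add: algebra_simps)
    have p2: "((\<lambda>\<theta>. u * (\<theta> * u) ^ (2 * j + 1) / fact (2 * j + 1) * a j) has_real_derivative
        u\<^sup>2 * (\<theta> * u) ^ (2 * j) / fact (2 * j) * a j) (at \<theta> within {0..1})" for j
      using DERIV_cmult[OF power_fact_has_derivative[of u "2 * j" "a j" \<theta> "{0..1}"], of u]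
      by (simp add: power2_eq_square mult.assoc del: fact_Suc power_Suc)
    show "(G1 has_real_derivative u\<^sup>2 * heat_rem n (\<theta> * u) (diff_gen f) y) (at \<theta> within {0..1})"
      unfolding G2 G1_def[abs_def]
      by (intro DERIV_diff DERIV_sum p2,
          rule DERIV_cong[OF DERIV_cdivide[OF DERIV_cmult[OF DERIV_diff[OF shift[OF h1] shift_minus[OF h1]]]]])
        (simp add: algebra_simps power2_eq_square)
  next
    have "continuous_on {0..1} (\<lambda>\<theta>. heat_rem n (\<theta> * u) (diff_gen f) y)"
      by (rule continuous_on_compose2[OF heat_rem_continuous[OF pol_bd_continuous[OF pol_bd_diff_gen[OF f]] y]])
        (auto intro!: continuous_intros)
    then show "continuous_on {0..1} (\<lambda>\<theta>. u\<^sup>2 * heat_rem n (\<theta> * u) (diff_gen f) y)"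
      by (intro continuous_intros)
  qed (simp add: G1_def)
  also have "\<dots> = heat_rem (Suc n) u f y"
    unfolding G_def heat_rem_def heat_avg_eq[OF y] a_def sum.lessThan_Suc_shift h_def x_def
    using y by (simp add: algebra_simps)
  finally show ?thesis by simp
qed

text \<open>Each application of \<open>diff_gen\<close> costs two derivatives and one degree; the
  starting average halves the remaining derivatives. The dependence on \<open>u\<close> is kept
  explicit because \<open>u\<close> becomes \<open>s * Z \<omega>\<close> and is then
  integrated.\<close>

lemma pol_bd_heat_rem:
  shows "\<exists>C\<ge>0. \<forall>u f K. pol_bd (2 * k + 2 * n) L K f \<longrightarrow>
     pol_bd k (L + n) (C * ((u\<^sup>2) ^ n * (1 + u\<^sup>2) ^ (L + n + k)) * K) (heat_rem n u f)"
proof (induction n arbitrary: L)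
  case 0
  have "pol_bd k L (2 * 4 ^ L * 3 ^ k * (1 + u\<^sup>2) ^ (L + k) * K) (heat_rem 0 u f)"
    if "pol_bd (2 * k) L K f" for u f K
    using pol_bd_sqrt_avg[OF that order_refl, of u] by (simp add: heat_rem_def[abs_def] heat_avg_def)
  then show ?case
    by (intro exI[of _ "2 * 4 ^ L * 3 ^ k"]) (simp add: mult.assoc)
next
  case (Suc n)
  obtain C where C: "0 \<le> C" and IH: "\<And>u f K. pol_bd (2 * k + 2 * n) (Suc L) K f \<Longrightarrow>
     pol_bd k (Suc L + n) (C * ((u\<^sup>2) ^ n * (1 + u\<^sup>2) ^ (Suc L + n + k)) * K) (heat_rem n u f)"
    using Suc[of "Suc L"] by blast
  define A where "A = 4 + 8 * (1 + real (2 * k + 2 * n))"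
  have A: "0 \<le> A" by (simp add: A_def)
  have "pol_bd k (L + Suc n) (C * A * ((u\<^sup>2) ^ Suc n * (1 + u\<^sup>2) ^ (L + Suc n + k)) * K) (heat_rem (Suc n) u f)"
    if f: "pol_bd (2 * k + 2 * Suc n) L K f" for u f K
  proof -
    have f': "pol_bd (Suc (Suc (2 * k + 2 * n))) L K f" using f by (simp del: pol_bd.simps)
    note Af = pol_bd_diff_gen[OF f', folded A_def]
    have K: "0 \<le> K" using pol_bd_nonneg[OF f] .
    define W where "W = C * A * ((u\<^sup>2) ^ Suc n * (1 + u\<^sup>2) ^ (L + Suc n + k)) * K"
    have "pol_bd k (Suc L + n) (\<integral>\<theta>. W \<partial>unit_measure)
       (\<lambda>y. \<integral>\<theta>. (1 - \<theta>) * (u\<^sup>2 * heat_rem n (\<theta> * u) (diff_gen f) y) \<partial>unit_measure)"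
    proof (rule pol_bd_integral)
      fix \<theta> assume "\<theta> \<in> space unit_measure"
      then have th: "\<theta> \<in> {0..1}" by (simp add: space_restrict_space)
      have le: "(\<theta> * u)\<^sup>2 \<le> u\<^sup>2"
        using scaled_param_le[OF order_refl th, of u] by (simp add: mult.commute)
      have bd: "pol_bd k (Suc L + n) (\<bar>1 - \<theta>\<bar> * (\<bar>u\<^sup>2\<bar> * (C * (((\<theta> * u)\<^sup>2) ^ n * (1 + (\<theta> * u)\<^sup>2) ^ (Suc L + n + k)) * (A * K))))
         (\<lambda>y. (1 - \<theta>) * (u\<^sup>2 * heat_rem n (\<theta> * u) (diff_gen f) y))"
        by (intro pol_bd_cmult IH Af)
      have le: "\<bar>1 - \<theta>\<bar> * (\<bar>u\<^sup>2\<bar> * (C * (((\<theta> * u)\<^sup>2) ^ n * (1 + (\<theta> * u)\<^sup>2) ^ (Suc L + n + k)) * (A * K)))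
         \<le> 1 * (u\<^sup>2 * (C * ((u\<^sup>2) ^ n * (1 + u\<^sup>2) ^ (Suc L + n + k)) * (A * K)))"
      proof -
        \<comment> \<open>Here r stands for (\<theta> u)^2, s for u^2 and e for 1 - \<theta>:
          shrinking \<open>u\<close> by \<theta> only lowers the bound.\<close>
        have mono: "e * (s * (C * (r ^ n * (1 + r) ^ q) * D)) \<le> 1 * (s * (C * (s ^ n * (1 + s) ^ q) * D))"
          if "0 \<le> r" "r \<le> s" "0 \<le> D" "0 \<le> e" "e \<le> 1" for r s D e :: real and q
          using that C by (intro mult_mono mult_nonneg_nonneg power_mono zero_le_power) auto
        show ?thesis
          unfolding abs_of_nonneg[OF zero_le_power2] by (intro mono) (use th le A K in auto)
      qed
      have eq: "1 * (u\<^sup>2 * (C * ((u\<^sup>2) ^ n * (1 + u\<^sup>2) ^ (Suc L + n + k)) * (A * K))) = W"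
        by (simp add: W_def)
      show "pol_bd k (Suc L + n) W (\<lambda>y. (1 - \<theta>) * (u\<^sup>2 * heat_rem n (\<theta> * u) (diff_gen f) y))"
        by (rule pol_bd_mono[OF bd le[unfolded eq]])
    next
      fix y :: real assume y: "0 \<le> y"
      have "continuous_on {0..1} (\<lambda>\<theta>. heat_rem n (\<theta> * u) (diff_gen f) y)"
        by (rule continuous_on_compose2[OF heat_rem_continuous[OF pol_bd_continuous[OF Af] y]])
          (auto intro!: continuous_intros)
      then show "(\<lambda>\<theta>. (1 - \<theta>) * (u\<^sup>2 * heat_rem n (\<theta> * u) (diff_gen f) y)) \<in> borel_measurable unit_measure"
        by (intro unit_measurable continuous_intros)
    qed (intro unit_integrable continuous_intros)
    then have "pol_bd k (L + Suc n) W
       (\<lambda>y. \<integral>\<theta>. (1 - \<theta>) * (u\<^sup>2 * heat_rem n (\<theta> * u) (diff_gen f) y) \<partial>unit_measure)"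
      unfolding unit_integral_const by simp
    then show ?thesis
      unfolding W_def by (rule pol_bd_cong) (use heat_rem_Suc[OF f'] in auto)
  qed
  then show ?case
    using C A by (intro exI[of _ "C * A"]) auto
qed

section \<open>The splitting error\<close>

text \<open>Reduces operator estimates to bookkeeping of derivatives, growth exponents and powers of
  \<open>t\<close>, with \<open>C\<close> uniform in \<open>t\<close> and \<open>f\<close>. Bounds
  for composite error terms then follow by chaining rules.\<close>

definition order_bd ::
  "real \<Rightarrow> nat \<Rightarrow> nat \<Rightarrow> nat \<Rightarrow> nat \<Rightarrow> nat \<Rightarrow> (real \<Rightarrow> (real \<Rightarrow> real) \<Rightarrow> real \<Rightarrow> real) \<Rightarrow> bool" where
  "order_bd T N k L k' L' P \<longleftrightarrow> (\<exists>C\<ge>0. \<forall>t\<in>{0..T}. \<forall>f K. pol_bd k L K f \<longrightarrow>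
     pol_bd k' L' (C * t ^ N * K) (P t f))"

text \<open>The indices are matched through separate equations, so that composed rules may first
  produce whatever sums arise and arithmetic settles them afterwards.\<close>

lemma order_bd_weaken:
  assumes "order_bd T N k L k' L' P" "N = M" "k \<le> j" "L' = L''"
  shows "order_bd T M j L k' L'' P"
  using assms pol_bd_le unfolding order_bd_def by blast

lemma order_bd_comp:
  assumes "order_bd T N k L k' L' P" "order_bd T N' k' L' k'' L'' P'"
  shows "order_bd T (N + N') k L k'' L'' (\<lambda>t f. P' t (P t f))"
proof -
  obtain C where C: "0 \<le> C" "\<And>t f K. t \<in> {0..T} \<Longrightarrow> pol_bd k L K f \<Longrightarrow> pol_bd k' L' (C * t ^ N * K) (P t f)"
    using assms(1) unfolding order_bd_def by blast
  obtain C' where C': "0 \<le> C'" "\<And>t f K. t \<in> {0..T} \<Longrightarrow> pol_bd k' L' K f \<Longrightarrow> pol_bd k'' L'' (C' * t ^ N' * K) (P' t f)"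
    using assms(2) unfolding order_bd_def by blast
  have "pol_bd k'' L'' (C' * C * t ^ (N + N') * K) (P' t (P t f))" if "t \<in> {0..T}" "pol_bd k L K f" for t f K
  proof -
    have "C' * t ^ N' * (C * t ^ N * K) = C' * C * t ^ (N + N') * K"
      by (simp add: power_add)
    with C'(2)[OF that(1) C(2)[OF that]] show ?thesis by simp
  qed
  then show ?thesis
    using C(1) C'(1) unfolding order_bd_def by (intro exI[of _ "C' * C"]) auto
qed

lemma order_bd_add:
  assumes "order_bd T N k L k' L' P" "order_bd T N k L k' L' P'"
  shows "order_bd T N k L k' L' (\<lambda>t f y. P t f y + P' t f y)"
proof -
  obtain C where C: "0 \<le> C" "\<And>t f K. t \<in> {0..T} \<Longrightarrow> pol_bd k L K f \<Longrightarrow> pol_bd k' L' (C * t ^ N * K) (P t f)"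
    using assms(1) unfolding order_bd_def by blast
  obtain C' where C': "0 \<le> C'" "\<And>t f K. t \<in> {0..T} \<Longrightarrow> pol_bd k L K f \<Longrightarrow> pol_bd k' L' (C' * t ^ N * K) (P' t f)"
    using assms(2) unfolding order_bd_def by blast
  have "pol_bd k' L' ((C + C') * t ^ N * K) (\<lambda>y. P t f y + P' t f y)" if "t \<in> {0..T}" "pol_bd k L K f" for t f K
    using pol_bd_add[OF C(2)[OF that] C'(2)[OF that]] by (simp add: distrib_right)
  then show ?thesis
    using C(1) C'(1) unfolding order_bd_def by (intro exI[of _ "C + C'"]) auto
qed

lemma order_bd_tmult:
  assumes "order_bd T N k L k' L' P"
  shows "order_bd T (N + j) k L k' L' (\<lambda>t f y. c * t ^ j * P t f y)"
proof -
  obtain C where C: "0 \<le> C" "\<And>t f K. t \<in> {0..T} \<Longrightarrow> pol_bd k L K f \<Longrightarrow> pol_bd k' L' (C * t ^ N * K) (P t f)"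
    using assms(1) unfolding order_bd_def by blast
  have "pol_bd k' L' (\<bar>c\<bar> * C * t ^ (N + j) * K) (\<lambda>y. c * t ^ j * P t f y)" if "t \<in> {0..T}" "pol_bd k L K f" for t f K
  proof -
    have "\<bar>c * t ^ j\<bar> * (C * t ^ N * K) = \<bar>c\<bar> * C * t ^ (N + j) * K"
      using that by (simp add: power_add abs_mult)
    with pol_bd_cmult[OF C(2)[OF that], of "c * t ^ j"] show ?thesis by simp
  qed
  then show ?thesis
    using C(1) unfolding order_bd_def by (intro exI[of _ "\<bar>c\<bar> * C"]) auto
qed

lemma order_bd_drift_gen: "order_bd T 0 (Suc k) L k (Suc L) (\<lambda>t. drift_gen b \<kappa>)"
  unfolding order_bd_def
  by (intro exI[of _ "2 * \<bar>\<kappa>\<bar> + 2 * \<bar>b\<bar> * (1 + real k)"])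
    (auto intro: pol_bd_drift_gen simp del: pol_bd.simps)

lemma order_bd_diff_gen: "order_bd T 0 (Suc (Suc k)) L k (Suc L) (\<lambda>t. diff_gen)"
  unfolding order_bd_def power_0 mult_1_right
  by (intro exI[of _ "4 + 8 * (1 + real k)"] conjI ballI allI impI pol_bd_diff_gen) auto

lemma order_bd_flow_rem:
  assumes "0 \<le> \<kappa>" "0 \<le> T"
  shows "order_bd T n (k + n) L k (L + n) (\<lambda>t. flow_rem b \<kappa> n (t / 2))"
proof -
  obtain C where C: "0 \<le> C" "\<And>\<tau> f K. \<tau> \<in> {0..T} \<Longrightarrow> pol_bd (k + n) L K f \<Longrightarrow>
     pol_bd k (L + n) (C * \<tau> ^ n * K) (flow_rem b \<kappa> n \<tau> f)"
    using pol_bd_flow_rem[OF assms] by blast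
  have "pol_bd k (L + n) (C / 2 ^ n * t ^ n * K) (flow_rem b \<kappa> n (t / 2) f)"
    if "t \<in> {0..T}" "pol_bd (k + n) L K f" for t f K
    using C(2)[OF _ that(2), of "t / 2"] that(1) by (simp add: power_divide)
  then show ?thesis
    using C(1) unfolding order_bd_def by (intro exI[of _ "C / 2 ^ n"]) auto
qed

lemma order_bd_flow:
  assumes "0 \<le> \<kappa>" "0 \<le> T"
  shows "order_bd T 0 k L k L (\<lambda>t f y. f (cir_flow b \<kappa> (t / 2) y))"
  \<comment> \<open>A remainder with no Taylor terms subtracted is the composition with the flow
    itself.\<close>
  using order_bd_flow_rem[OF assms, of 0 k L b] by (simp add: flow_rem_def[abs_def])

section \<open>The CIR generator in terms of the two parts of the splitting\<close>

lemma drift_gen_lincomb: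
  assumes "pol_bd (Suc k) L K f" "pol_bd (Suc k') L' K' g" "0 \<le> y"
  shows "drift_gen b \<kappa> (\<lambda>y. f y + c * g y) y = drift_gen b \<kappa> f y + c * drift_gen b \<kappa> g y"
  unfolding drift_gen_def deriv_Rp_lincomb[OF assms] by (simp add: algebra_simps)

lemma diff_gen_lincomb:
  assumes "pol_bd (Suc (Suc k)) L K f" "pol_bd (Suc (Suc k')) L' K' g" "0 \<le> y"
  shows "diff_gen (\<lambda>y. f y + c * g y) y = diff_gen f y + c * diff_gen g y"
proof -
  have "deriv_Rp (deriv_Rp (\<lambda>y. f y + c * g y)) y = deriv_Rp (\<lambda>y. deriv_Rp f y + c * deriv_Rp g y) y"
    by (rule deriv_Rp_cong[OF deriv_Rp_lincomb[OF assms(1,2)] assms(3)])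
  also have "\<dots> = deriv_Rp (deriv_Rp f) y + c * deriv_Rp (deriv_Rp g) y"
    by (rule deriv_Rp_lincomb[OF pol_bd_deriv_Rp(1)[OF assms(1)] pol_bd_deriv_Rp(1)[OF assms(2)] assms(3)])
  finally show ?thesis
    unfolding diff_gen_def deriv_Rp_lincomb[OF assms] by (simp add: algebra_simps)
qed

text \<open>The first-order part 2 f' of \<open>diff_gen\<close> contributes \<sigma>^2/4 f', which
  is why the drift constant drops from \<open>a\<close> to a - \<sigma>^2/4.\<close>

lemma cir_gen_eq:
  "cir_gen a b \<sigma> f = (\<lambda>y. drift_gen b (a - \<sigma>\<^sup>2 / 4) f y + \<sigma>\<^sup>2 / 8 * diff_gen f y)"
  by (simp add: fun_eq_iff cir_gen_def drift_gen_def diff_gen_def numeral_2_eq_2 field_simps)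

text \<open>B and A need not commute, so both mixed products remain. Four derivatives of
  \<open>f\<close> leave two for A f and B f, as the second application of \<open>diff_gen\<close>
  requires.\<close>

lemma cir_gen_cir_gen_eq:
  fixes a b \<sigma> :: real
  assumes "pol_bd 4 L K f" "0 \<le> y"
  defines "B \<equiv> drift_gen b (a - \<sigma>\<^sup>2 / 4)"
  shows "cir_gen a b \<sigma> (cir_gen a b \<sigma> f) y =
    B (B f) y + \<sigma>\<^sup>2 / 8 * (B (diff_gen f) y + diff_gen (B f) y) + (\<sigma>\<^sup>2 / 8)\<^sup>2 * diff_gen (diff_gen f) y"
proof -
  have f: "pol_bd (Suc (Suc (Suc (Suc 0)))) L K f"
    using assms(1) by (simp add: eval_nat_numeral del: pol_bd.simps)
  note A = pol_bd_diff_gen[OF f]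
  note B = pol_bd_Suc_le[OF pol_bd_drift_gen[OF f, of "a - \<sigma>\<^sup>2 / 4" b]]
  show ?thesis
    unfolding cir_gen_eq drift_gen_lincomb[OF B A assms(2)] diff_gen_lincomb[OF B A assms(2)] B_def
    by (simp add: algebra_simps power2_eq_square)
qed

section \<open>The random step and the expansion of the scheme\<close>

locale moment_matched = prob_space M for M :: "'w measure" +
  fixes Z :: "'w \<Rightarrow> real"
  assumes Z [measurable]: "Z \<in> borel_measurable M"
    and symmetric: "distr M borel (\<lambda>\<omega>. - Z \<omega>) = distr M borel Z"
    and moments: "\<And>k::nat. integrable M (\<lambda>\<omega>. \<bar>Z \<omega>\<bar> ^ k)"
    and moment2: "(\<integral>\<omega>. Z \<omega> ^ 2 \<partial>M) = 1"
    and moment4: "(\<integral>\<omega>. Z \<omega> ^ 4 \<partial>M) = 3"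
begin

lemma integrable_even_power: "integrable M (\<lambda>\<omega>. ((Z \<omega>)\<^sup>2) ^ q)"
  using moments[of "2 * q"] by (simp add: power_mult)

text \<open>This is the random constant in the bound of \<open>pol_bd_heat_rem\<close>. It is at
  most (1 + Z^2)^(n+p), which \<open>growth_le\<close> reduces to a single even moment.\<close>

lemma integrable_growth: "integrable M (\<lambda>\<omega>. ((Z \<omega>)\<^sup>2) ^ n * (1 + (Z \<omega>)\<^sup>2) ^ p)"
proof (rule Bochner_Integration.integrable_bound)
  show "integrable M (\<lambda>\<omega>. 2 * 2 ^ (n + p) * (1 + ((Z \<omega>)\<^sup>2) ^ (n + p)))"
    using integrable_even_power[of "n + p"] by simp
  have "((Z \<omega>)\<^sup>2) ^ n * (1 + (Z \<omega>)\<^sup>2) ^ p \<le> 2 * 2 ^ (n + p) * (1 + ((Z \<omega>)\<^sup>2) ^ (n + p))" for \<omega>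
  proof -
    have "((Z \<omega>)\<^sup>2) ^ n * (1 + (Z \<omega>)\<^sup>2) ^ p \<le> (1 + (Z \<omega>)\<^sup>2) ^ n * (1 + (Z \<omega>)\<^sup>2) ^ p"
      by (intro mult_right_mono power_mono) auto
    also have "\<dots> = (1 + (Z \<omega>)\<^sup>2) ^ (n + p)"
      by (simp add: power_add)
    also have "\<dots> \<le> 1 + (1 + (Z \<omega>)\<^sup>2) ^ (n + p)"
      by simp
    also have "\<dots> \<le> 2 * (2 * 1) ^ (n + p) * (1 + ((Z \<omega>)\<^sup>2) ^ (n + p))"
      by (rule growth_le) auto
    finally show ?thesis by simp
  qed
  then show "AE \<omega> in M. norm (((Z \<omega>)\<^sup>2) ^ n * (1 + (Z \<omega>)\<^sup>2) ^ p)
      \<le> norm (2 * 2 ^ (n + p) * (1 + ((Z \<omega>)\<^sup>2) ^ (n + p)))"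
    unfolding real_norm_def
    by (intro AE_I2 order_trans[OF _ abs_ge_self]) simp
qed measurable

text \<open>The symmetrised average is integrated pathwise, because smoothness up to y = 0 is
  available for it rather than for f((sqrt y + s Z)^2) alone.\<close>

definition heat_mean :: "real \<Rightarrow> (real \<Rightarrow> real) \<Rightarrow> real \<Rightarrow> real" where
  "heat_mean s f y = (\<integral>\<omega>. heat_avg (s * Z \<omega>) f y \<partial>M)"

text \<open>The coefficients come from the exponential series of s^2/2 times
  \<open>diff_gen\<close>, equivalently from the even moments of a standard Gaussian.\<close>

definition heat_mean_rem :: "nat \<Rightarrow> real \<Rightarrow> (real \<Rightarrow> real) \<Rightarrow> real \<Rightarrow> real" where
  "heat_mean_rem n s f y = heat_mean s f y - (\<Sum>j<n. (s\<^sup>2 / 2) ^ j / fact j * (diff_gen ^^ j) f y)"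

lemma heat_integrable:
  assumes "pol_bd k L K f" "0 \<le> y"
  shows "integrable M (\<lambda>\<omega>. f ((sqrt y + s * Z \<omega>)\<^sup>2))"
proof (rule Bochner_Integration.integrable_bound)
  \<comment> \<open>Chosen so that (sqrt y + s Z)^2 <= g (1 + Z^2); \<open>growth_le\<close> then
    applies with Z^2 in the role of its variable.\<close>
  define g where "g = 1 + 2 * y + 2 * s\<^sup>2"
  have g: "1 \<le> g" using assms(2) by (simp add: g_def)
  show "integrable M (\<lambda>\<omega>. K * (2 * (2 * g) ^ L * (1 + ((Z \<omega>)\<^sup>2) ^ L)))"
    using integrable_even_power[of L] by simp
  have "continuous_on UNIV (\<lambda>z. f ((sqrt y + s * z)\<^sup>2))"
    by (intro continuous_on_Rp_compose[OF pol_bd_continuous[OF assms(1)]] continuous_intros) auto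
  then show "(\<lambda>\<omega>. f ((sqrt y + s * Z \<omega>)\<^sup>2)) \<in> borel_measurable M"
    by (intro measurable_compose[OF Z]) (simp add: borel_measurable_continuous_onI)
  have "\<bar>f ((sqrt y + s * Z \<omega>)\<^sup>2)\<bar> \<le> K * (2 * (2 * g) ^ L * (1 + ((Z \<omega>)\<^sup>2) ^ L))" for \<omega>
  proof -
    have "0 \<le> (sqrt y - s * Z \<omega>)\<^sup>2" by simp
    then have "(sqrt y + s * Z \<omega>)\<^sup>2 \<le> 2 * y + 2 * (s\<^sup>2 * (Z \<omega>)\<^sup>2)"
      using assms(2) by (simp add: power2_sum power2_diff power_mult_distrib)
    also have "\<dots> \<le> 2 * y + 2 * (s\<^sup>2 * (Z \<omega>)\<^sup>2) + (1 + 2 * s\<^sup>2 + (Z \<omega>)\<^sup>2 + 2 * (y * (Z \<omega>)\<^sup>2))"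
      using assms(2) by simp
    also have "\<dots> = g * (1 + (Z \<omega>)\<^sup>2)"
      by (simp add: g_def algebra_simps)
    finally have le: "(sqrt y + s * Z \<omega>)\<^sup>2 \<le> g * (1 + (Z \<omega>)\<^sup>2)" .
    have "\<bar>f ((sqrt y + s * Z \<omega>)\<^sup>2)\<bar> \<le> K * (1 + ((sqrt y + s * Z \<omega>)\<^sup>2) ^ L)"
      by (rule pol_bd_bound[OF assms(1)]) simp
    also have "\<dots> \<le> K * (2 * (2 * g) ^ L * (1 + ((Z \<omega>)\<^sup>2) ^ L))"
      using le g by (intro mult_left_mono growth_le pol_bd_nonneg[OF assms(1)]) auto
    finally show ?thesis .
  qed
  then show "AE \<omega> in M. norm (f ((sqrt y + s * Z \<omega>)\<^sup>2)) \<le> norm (K * (2 * (2 * g) ^ L * (1 + ((Z \<omega>)\<^sup>2) ^ L)))"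
    unfolding real_norm_def by (intro AE_I2 order_trans[OF _ abs_ge_self])
qed

lemma heat_avg_integrable:
  assumes "pol_bd k L K f" "0 \<le> y"
  shows "integrable M (\<lambda>\<omega>. heat_avg (s * Z \<omega>) f y)"
  using heat_integrable[OF assms, of s] heat_integrable[OF assms, of "- s"]
  unfolding heat_avg_eq[OF assms(2)] by simp

text \<open>Z and -Z have the same law, so both halves of the symmetrised average have the same
  expectation.\<close>

lemma heat_mean_eq:
  assumes "pol_bd k L K f" "0 \<le> y"
  shows "(\<integral>\<omega>. f ((sqrt y + s * Z \<omega>)\<^sup>2) \<partial>M) = heat_mean s f y"
proof -
  define g where "g z = f ((sqrt y + s * z)\<^sup>2)" for z
  have "continuous_on UNIV g"
    unfolding g_def[abs_def]
    by (intro continuous_on_Rp_compose[OF pol_bd_continuous[OF assms(1)]] continuous_intros) auto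
  then have [measurable]: "g \<in> borel_measurable borel"
    by (simp add: borel_measurable_continuous_onI)
  have "(\<integral>\<omega>. g (- Z \<omega>) \<partial>M) = (\<integral>z. g z \<partial>distr M borel (\<lambda>\<omega>. - Z \<omega>))"
    by (subst integral_distr) auto
  also have "\<dots> = (\<integral>\<omega>. g (Z \<omega>) \<partial>M)"
    unfolding symmetric by (subst integral_distr) auto
  finally have "(\<integral>\<omega>. g (- Z \<omega>) \<partial>M) = (\<integral>\<omega>. g (Z \<omega>) \<partial>M)" .
  moreover have "integrable M (\<lambda>\<omega>. g (Z \<omega>))" "integrable M (\<lambda>\<omega>. g (- Z \<omega>))"
    using heat_integrable[OF assms, of s] heat_integrable[OF assms, of "- s"] by (simp_all add: g_def)
  moreover have "heat_mean s f y = (\<integral>\<omega>. (g (Z \<omega>) + g (- Z \<omega>)) / 2 \<partial>M)"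
    by (simp add: heat_mean_def heat_avg_eq[OF assms(2)] g_def)
  ultimately show ?thesis
    unfolding g_def[symmetric] by simp
qed

lemma heat_mean_lincomb:
  assumes "\<And>i. i \<in> I \<Longrightarrow> pol_bd k (L i) (K i) (f i)" "0 \<le> y"
  shows "heat_mean s (\<lambda>y. \<Sum>i\<in>I. c i * f i y) y = (\<Sum>i\<in>I. c i * heat_mean s (f i) y)"
proof -
  have "heat_avg u (\<lambda>y. \<Sum>i\<in>I. c i * f i y) y = (\<Sum>i\<in>I. c i * heat_avg u (f i) y)" for u
    by (simp add: heat_avg_def sqrt_avg_def sum.distrib sum_divide_distrib distrib_left add_divide_distrib)
  then show ?thesis
    using heat_avg_integrable[OF assms(1) assms(2), of _ s]
    by (simp add: heat_mean_def)
qed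

lemma heat_mean_cong:
  assumes "\<And>x. 0 \<le> x \<Longrightarrow> f x = g x" "0 \<le> y"
  shows "heat_mean s f y = heat_mean s g y"
  using assms by (simp add: heat_mean_def heat_avg_eq)

text \<open>Matching with the exponential series for j = 0, 1, 2; in the last case 3/4! =
  (1/2)^2/2!.\<close>

lemma normalised_even_moment:
  assumes "j < 3"
  shows "integrable M (\<lambda>\<omega>. (s * Z \<omega>) ^ (2 * j) / fact (2 * j))"
    and "(\<integral>\<omega>. (s * Z \<omega>) ^ (2 * j) / fact (2 * j) \<partial>M) = (s\<^sup>2 / 2) ^ j / fact j"
proof -
  show "integrable M (\<lambda>\<omega>. (s * Z \<omega>) ^ (2 * j) / fact (2 * j))"
    using integrable_even_power[of j] by (simp add: power_mult_distrib power_mult)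
  from assms consider "j = 0" | "j = 1" | "j = 2" by linarith
  then show "(\<integral>\<omega>. (s * Z \<omega>) ^ (2 * j) / fact (2 * j) \<partial>M) = (s\<^sup>2 / 2) ^ j / fact j"
  proof cases
    case 1
    then show ?thesis by (simp add: prob_space)
  next
    case 2
    then show ?thesis by (simp add: power_mult_distrib moment2)
  next
    case 3
    then show ?thesis
      by (simp add: power_mult_distrib moment4 fact_numeral power_divide)
  qed
qed

text \<open>Integrating the pathwise remainder term by term involves only moments up to order 4 when
  n <= 3, and these are the ones that match.\<close>

lemma heat_mean_rem_eq:
  assumes "pol_bd k L K f" "0 \<le> y" "n \<le> 3"
  shows "heat_mean_rem n s f y = (\<integral>\<omega>. heat_rem n (s * Z \<omega>) f y \<partial>M)"
  unfolding heat_rem_def heat_mean_rem_def heat_mean_def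
proof -
  define a where "a j = (diff_gen ^^ j) f y" for j
  have int: "integrable M (\<lambda>\<omega>. (s * Z \<omega>) ^ (2 * j) / fact (2 * j) * a j)"
    and eq: "(\<integral>\<omega>. (s * Z \<omega>) ^ (2 * j) / fact (2 * j) * a j \<partial>M) = (s\<^sup>2 / 2) ^ j / fact j * a j"
    if "j \<in> {..<n}" for j
  proof -
    have j: "j < 3" using that assms(3) by simp
    show "integrable M (\<lambda>\<omega>. (s * Z \<omega>) ^ (2 * j) / fact (2 * j) * a j)"
      by (rule integrable_mult_left[OF normalised_even_moment(1)[OF j]])
    show "(\<integral>\<omega>. (s * Z \<omega>) ^ (2 * j) / fact (2 * j) * a j \<partial>M) = (s\<^sup>2 / 2) ^ j / fact j * a j"
      unfolding integral_mult_left_zero normalised_even_moment(2)[OF j] ..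
  qed
  have "(\<integral>\<omega>. heat_avg (s * Z \<omega>) f y - (\<Sum>j<n. (s * Z \<omega>) ^ (2 * j) / fact (2 * j) * a j) \<partial>M) =
      (\<integral>\<omega>. heat_avg (s * Z \<omega>) f y \<partial>M) - (\<integral>\<omega>. (\<Sum>j<n. (s * Z \<omega>) ^ (2 * j) / fact (2 * j) * a j) \<partial>M)"
    by (intro Bochner_Integration.integral_diff heat_avg_integrable[OF assms(1,2)]
        Bochner_Integration.integrable_sum int)
  also have "(\<integral>\<omega>. (\<Sum>j<n. (s * Z \<omega>) ^ (2 * j) / fact (2 * j) * a j) \<partial>M) =
      (\<Sum>j<n. \<integral>\<omega>. (s * Z \<omega>) ^ (2 * j) / fact (2 * j) * a j \<partial>M)"
    by (rule Bochner_Integration.integral_sum[OF int])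
  also have "\<dots> = (\<Sum>j<n. (s\<^sup>2 / 2) ^ j / fact j * a j)"
    by (rule sum.cong[OF refl eq])
  finally show "(\<integral>\<omega>. heat_avg (s * Z \<omega>) f y \<partial>M) - (\<Sum>j<n. (s\<^sup>2 / 2) ^ j / fact j * (diff_gen ^^ j) f y) =
      (\<integral>\<omega>. heat_avg (s * Z \<omega>) f y - (\<Sum>j<n. (s * Z \<omega>) ^ (2 * j) / fact (2 * j) * (diff_gen ^^ j) f y) \<partial>M)"
    unfolding a_def by (rule sym)
qed

text \<open>Here (s Z)^2 is proportional to t Z^2, so its n-th power releases t^n. The remaining
  growth factor splits into a constant depending on \<open>T\<close> and a power of 1 + Z^2, which
  is integrated.\<close>

lemma order_bd_heat_mean_rem:
  assumes "n \<le> 3" "0 \<le> T"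
  shows "order_bd T n (2 * k + 2 * n) L k (L + n) (\<lambda>t. heat_mean_rem n (\<sigma> * sqrt t / 2))"
proof -
  define p where "p = L + n + k"
  obtain C where C: "0 \<le> C" "\<And>u f K. pol_bd (2 * k + 2 * n) L K f \<Longrightarrow>
     pol_bd k (L + n) (C * ((u\<^sup>2) ^ n * (1 + u\<^sup>2) ^ p) * K) (heat_rem n u f)"
    using pol_bd_heat_rem[of k n L] unfolding p_def by blast
  define V where "V = (\<integral>\<omega>. ((Z \<omega>)\<^sup>2) ^ n * (1 + (Z \<omega>)\<^sup>2) ^ p \<partial>M)"
  have V: "0 \<le> V" unfolding V_def by (intro integral_nonneg_AE AE_I2) auto
  \<comment> \<open>\<open>c\<close> collects the deterministic factors: the coefficient of t^n, and
    the growth factor with \<open>t\<close> replaced by \<open>T\<close>.\<close>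
  define c where "c = (\<sigma>\<^sup>2 / 4) ^ n * (1 + \<sigma>\<^sup>2 / 4 * T) ^ p"
  have c: "0 \<le> c" using assms(2) by (simp add: c_def)
  have "pol_bd k (L + n) (C * c * V * t ^ n * K) (heat_mean_rem n (\<sigma> * sqrt t / 2) f)"
    if t: "t \<in> {0..T}" and f: "pol_bd (2 * k + 2 * n) L K f" for t f K
  proof -
    define s where "s = \<sigma> * sqrt t / 2"
    have s2: "s\<^sup>2 = \<sigma>\<^sup>2 / 4 * t" using t by (simp add: s_def power_mult_distrib power_divide)
    define W where "W \<omega> = C * c * t ^ n * K * (((Z \<omega>)\<^sup>2) ^ n * (1 + (Z \<omega>)\<^sup>2) ^ p)" for \<omega>
    have "pol_bd k (L + n) (\<integral>\<omega>. W \<omega> \<partial>M) (\<lambda>y. \<integral>\<omega>. heat_rem n (s * Z \<omega>) f y \<partial>M)"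
    proof (rule pol_bd_integral)
      show "integrable M W"
        unfolding W_def[abs_def] using integrable_growth[of n p] by simp
      show "(\<lambda>\<omega>. heat_rem n (s * Z \<omega>) f y) \<in> borel_measurable M" if "0 \<le> y" for y
        by (rule borel_measurable_continuous_on[OF heat_rem_continuous[OF pol_bd_continuous[OF f] that]]) simp
      fix \<omega>
      define z where "z = (Z \<omega>)\<^sup>2"
      have z: "0 \<le> z" by (simp add: z_def)
      have sz: "(s * Z \<omega>)\<^sup>2 = s\<^sup>2 * z" by (simp add: z_def power_mult_distrib)
      have le: "1 + s\<^sup>2 * z \<le> (1 + \<sigma>\<^sup>2 / 4 * T) * (1 + z)"
      proof -
        have "s\<^sup>2 \<le> \<sigma>\<^sup>2 / 4 * T" unfolding s2 using t by (intro mult_left_mono) auto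
        from mult_right_mono[OF this z] have "s\<^sup>2 * z \<le> \<sigma>\<^sup>2 / 4 * T * z" .
        moreover have "0 \<le> \<sigma>\<^sup>2 / 4 * T" using assms(2) by simp
        moreover have "(1 + \<sigma>\<^sup>2 / 4 * T) * (1 + z) = 1 + \<sigma>\<^sup>2 / 4 * T + z + \<sigma>\<^sup>2 / 4 * T * z"
          by (simp add: algebra_simps)
        ultimately show ?thesis using z by linarith
      qed
      have "C * (((s * Z \<omega>)\<^sup>2) ^ n * (1 + (s * Z \<omega>)\<^sup>2) ^ p) * K
          \<le> C * ((s\<^sup>2 * z) ^ n * ((1 + \<sigma>\<^sup>2 / 4 * T) * (1 + z)) ^ p) * K"
        unfolding sz using C(1) z le pol_bd_nonneg[OF f]
        by (intro mult_right_mono mult_left_mono power_mono) auto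
      also have "\<dots> = W \<omega>"
        unfolding W_def c_def s2 z_def[symmetric] power_mult_distrib by (simp only: mult_ac)
      finally show "pol_bd k (L + n) (W \<omega>) (heat_rem n (s * Z \<omega>) f)"
        by (rule pol_bd_mono[OF C(2)[OF f]])
    qed
    moreover have "(\<integral>\<omega>. W \<omega> \<partial>M) = C * c * V * t ^ n * K"
      unfolding W_def V_def by simp
    ultimately show ?thesis
      using heat_mean_rem_eq[OF f _ assms(1), of _ s] unfolding s_def[symmetric]
      by (auto elim: pol_bd_cong)
  qed
  then show ?thesis
    using C(1) c V unfolding order_bd_def by (intro exI[of _ "C * c * V"]) auto
qed

lemma order_bd_heat_mean:
  assumes "0 \<le> T"
  shows "order_bd T 0 (2 * k) L k L (\<lambda>t. heat_mean (\<sigma> * sqrt t / 2))"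
  using order_bd_heat_mean_rem[of 0, OF _ assms, of k L \<sigma>] by (simp add: heat_mean_rem_def[abs_def])

text \<open>Each factor of the splitting is expanded, from the innermost one outwards, just far enough to
  leave a remainder of total order 3 in \<open>t\<close>; the coefficients use \<open>s\<^sup>2 / 2 = \<sigma>\<^sup>2 t / 8\<close>.\<close>

definition scheme_error :: "real \<Rightarrow> real \<Rightarrow> real \<Rightarrow> real \<Rightarrow> (real \<Rightarrow> real) \<Rightarrow> real \<Rightarrow> real" where
  "scheme_error b \<kappa> \<sigma> t f y =
     flow_rem b \<kappa> 3 (t / 2) f y
     + \<sigma>\<^sup>2 / 8 * t ^ 1 * flow_rem b \<kappa> 2 (t / 2) (diff_gen f) y
     + \<sigma> ^ 4 / 128 * t ^ 2 * flow_rem b \<kappa> 1 (t / 2) (diff_gen (diff_gen f)) y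
     + heat_mean_rem 3 (\<sigma> * sqrt t / 2) f (cir_flow b \<kappa> (t / 2) y)
     + 1 / 2 * t ^ 1 * flow_rem b \<kappa> 2 (t / 2) (drift_gen b \<kappa> f) y
     + \<sigma>\<^sup>2 / 16 * t ^ 2 * flow_rem b \<kappa> 1 (t / 2) (diff_gen (drift_gen b \<kappa> f)) y
     + 1 / 2 * t ^ 1 * heat_mean_rem 2 (\<sigma> * sqrt t / 2) (drift_gen b \<kappa> f) (cir_flow b \<kappa> (t / 2) y)
     + 1 / 8 * t ^ 2 * flow_rem b \<kappa> 1 (t / 2) (drift_gen b \<kappa> (drift_gen b \<kappa> f)) y
     + 1 / 8 * t ^ 2 * heat_mean_rem 1 (\<sigma> * sqrt t / 2) (drift_gen b \<kappa> (drift_gen b \<kappa> f)) (cir_flow b \<kappa> (t / 2) y)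
     + heat_mean (\<sigma> * sqrt t / 2) (flow_rem b \<kappa> 3 (t / 2) f) (cir_flow b \<kappa> (t / 2) y)"

text \<open>In every summand the explicit power of \<open>t\<close> and the order of the remainder
  add up to 3, and the degree rises by 3. The largest demand on derivatives, 2m + 6, comes from
  \<open>heat_mean_rem 3\<close>.\<close>

lemma order_bd_scheme_error:
  assumes "0 \<le> \<kappa>" "0 \<le> T"
  shows "order_bd T 3 (2 * (m + 3)) L m (L + 3) (scheme_error b \<kappa> \<sigma>)"
proof -
  note F = order_bd_flow_rem[OF assms, where b = b]
  note B = order_bd_drift_gen[where T = T and b = b and \<kappa> = \<kappa>]
  note A = order_bd_diff_gen[where T = T]
  note H = order_bd_heat_mean_rem[OF _ assms(2), where \<sigma> = \<sigma>]
  note E = order_bd_flow[OF assms, where b = b]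
  note Q = order_bd_heat_mean[OF assms(2), where \<sigma> = \<sigma>]
  note w = order_bd_weaken[where M = 3 and j = "2 * (m + 3)" and L'' = "L + 3"]
  note c = order_bd_comp
  note tm = order_bd_tmult
  show ?thesis
    unfolding scheme_error_def[abs_def]
  proof (intro order_bd_add)
    show "order_bd T 3 (2 * (m + 3)) L m (L + 3) (\<lambda>t. flow_rem b \<kappa> 3 (t / 2))"
      by (rule w[OF F]) auto
    show "order_bd T 3 (2 * (m + 3)) L m (L + 3)
        (\<lambda>t f y. \<sigma>\<^sup>2 / 8 * t ^ 1 * flow_rem b \<kappa> 2 (t / 2) (diff_gen f) y)"
      by (rule w[OF tm[OF c[OF A F]]]) auto
    show "order_bd T 3 (2 * (m + 3)) L m (L + 3)
        (\<lambda>t f y. \<sigma> ^ 4 / 128 * t ^ 2 * flow_rem b \<kappa> 1 (t / 2) (diff_gen (diff_gen f)) y)"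
      by (rule w[OF tm[OF c[OF c[OF A A] F]]]) auto
    show "order_bd T 3 (2 * (m + 3)) L m (L + 3)
        (\<lambda>t f y. heat_mean_rem 3 (\<sigma> * sqrt t / 2) f (cir_flow b \<kappa> (t / 2) y))"
      by (rule w[OF c[OF H E]]) auto
    show "order_bd T 3 (2 * (m + 3)) L m (L + 3)
        (\<lambda>t f y. 1 / 2 * t ^ 1 * flow_rem b \<kappa> 2 (t / 2) (drift_gen b \<kappa> f) y)"
      by (rule w[OF tm[OF c[OF B F]]]) auto
    show "order_bd T 3 (2 * (m + 3)) L m (L + 3)
        (\<lambda>t f y. \<sigma>\<^sup>2 / 16 * t ^ 2 * flow_rem b \<kappa> 1 (t / 2) (diff_gen (drift_gen b \<kappa> f)) y)"
      by (rule w[OF tm[OF c[OF c[OF B A] F]]]) auto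
    show "order_bd T 3 (2 * (m + 3)) L m (L + 3)
        (\<lambda>t f y. 1 / 2 * t ^ 1 * heat_mean_rem 2 (\<sigma> * sqrt t / 2) (drift_gen b \<kappa> f) (cir_flow b \<kappa> (t / 2) y))"
      by (rule w[OF tm[OF c[OF B c[OF H E]]]]) auto
    show "order_bd T 3 (2 * (m + 3)) L m (L + 3)
        (\<lambda>t f y. 1 / 8 * t ^ 2 * flow_rem b \<kappa> 1 (t / 2) (drift_gen b \<kappa> (drift_gen b \<kappa> f)) y)"
      by (rule w[OF tm[OF c[OF c[OF B B] F]]]) auto
    show "order_bd T 3 (2 * (m + 3)) L m (L + 3)
        (\<lambda>t f y. 1 / 8 * t ^ 2 * heat_mean_rem 1 (\<sigma> * sqrt t / 2) (drift_gen b \<kappa> (drift_gen b \<kappa> f)) (cir_flow b \<kappa> (t / 2) y))"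
      by (rule w[OF tm[OF c[OF c[OF B B] c[OF H E]]]]) auto
    show "order_bd T 3 (2 * (m + 3)) L m (L + 3)
        (\<lambda>t f y. heat_mean (\<sigma> * sqrt t / 2) (flow_rem b \<kappa> 3 (t / 2) f) (cir_flow b \<kappa> (t / 2) y))"
      by (rule w[OF c[OF F c[OF Q E]]]) auto
  qed
qed

lemma scheme_expansion:
  assumes f: "pol_bd 6 L K f" and "0 \<le> a - \<sigma>\<^sup>2 / 4" "0 \<le> t" "0 \<le> y"
  shows "integrable M (\<lambda>\<omega>. f (Y_hat a b \<sigma> t y (Z \<omega>)))"
    and "(\<integral>\<omega>. f (Y_hat a b \<sigma> t y (Z \<omega>)) \<partial>M) =
      f y + t * cir_gen a b \<sigma> f y + t\<^sup>2 / 2 * cir_gen a b \<sigma> (cir_gen a b \<sigma> f) y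
      + scheme_error b (a - \<sigma>\<^sup>2 / 4) \<sigma> t f y"
proof -
  define \<kappa> where "\<kappa> = a - \<sigma>\<^sup>2 / 4"
  define \<tau> where "\<tau> = t / 2"
  define s where "s = \<sigma> * sqrt t / 2"
  define B where "B = drift_gen b \<kappa>"
  define x where "x = cir_flow b \<kappa> \<tau> y"
  define Ef where "Ef = (\<lambda>z. f (cir_flow b \<kappa> \<tau> z))"
  have k: "0 \<le> \<kappa>" and tau: "0 \<le> \<tau>" using assms by (simp_all add: \<kappa>_def \<tau>_def)
  have x: "0 \<le> x" unfolding x_def by (rule cir_flow_nonneg[OF k tau assms(4)])
  have Y: "Y_hat a b \<sigma> t y z = cir_flow b \<kappa> \<tau> ((sqrt x + s * z)\<^sup>2)" for z
    by (simp add: Y_hat_def x_def cir_flow_def \<tau>_def \<kappa>_def s_def)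
  have f4: "pol_bd 4 L K f" and f3: "pol_bd (0 + 3) L K f"
    and f2: "pol_bd (Suc (Suc 0)) L K f" and f0: "pol_bd 0 L K f"
    using pol_bd_le[OF f] by (simp_all del: pol_bd.simps)
  note Bf = pol_bd_drift_gen[OF f2, of \<kappa> b, folded B_def]
  note BBf = pol_bd_drift_gen[OF Bf, of \<kappa> b, folded B_def]
  note Ef = pol_bd_flow[OF f0 k tau order_refl, of b, folded Ef_def]
  \<comment> \<open>Only some bound without derivatives is wanted here, to make the remainder
    integrable when the mean is split.\<close>
  obtain K' where rem: "pol_bd 0 (L + 3) K' (flow_rem b \<kappa> 3 \<tau> f)"
    using pol_bd_flow_rem[OF k tau, of 0 3 L b] tau f3 by fastforce
  show "integrable M (\<lambda>\<omega>. f (Y_hat a b \<sigma> t y (Z \<omega>)))"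
    using heat_integrable[OF Ef x, of s] by (simp add: Y Ef_def)
  have fl1: "g x = g y + flow_rem b \<kappa> 1 \<tau> g y" for g
    by (simp add: flow_rem_def x_def)
  have fl2: "g x = g y + \<tau> * B g y + flow_rem b \<kappa> 2 \<tau> g y" for g
    by (simp add: flow_rem_def x_def B_def eval_nat_numeral)
  have flow3: "g (cir_flow b \<kappa> \<tau> z) = g z + \<tau> * B g z + \<tau>\<^sup>2 / 2 * B (B g) z + flow_rem b \<kappa> 3 \<tau> g z" for g z
    by (simp add: flow_rem_def B_def eval_nat_numeral)
  note fl3 = flow3[of _ y, folded x_def]
  define e where "e = s\<^sup>2 / 2"
  have e: "e = \<sigma>\<^sup>2 / 8 * t"
    using assms(3) by (simp add: e_def s_def power_mult_distrib power_divide)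
  have hm1: "heat_mean s g x = g x + heat_mean_rem 1 s g x" for g
    by (simp add: heat_mean_rem_def)
  have hm2: "heat_mean s g x = g x + e * diff_gen g x + heat_mean_rem 2 s g x" for g
    by (simp add: heat_mean_rem_def e_def eval_nat_numeral)
  have hm3: "heat_mean s g x = g x + e * diff_gen g x + e\<^sup>2 / 2 * diff_gen (diff_gen g) x + heat_mean_rem 3 s g x" for g
    by (simp add: heat_mean_rem_def e_def eval_nat_numeral)
  have "(\<integral>\<omega>. f (Y_hat a b \<sigma> t y (Z \<omega>)) \<partial>M) = heat_mean s Ef x"
    using heat_mean_eq[OF Ef x, of s] by (simp add: Y Ef_def)
  also have "\<dots> = heat_mean s f x + \<tau> * heat_mean s (B f) x + \<tau>\<^sup>2 / 2 * heat_mean s (B (B f)) x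
      + heat_mean s (flow_rem b \<kappa> 3 \<tau> f) x"
  proof -
    \<comment> \<open>Listing the four Taylor terms by index allows one use of
      \<open>heat_mean_lincomb\<close>.\<close>
    define G where "G i = [f, B f, B (B f), flow_rem b \<kappa> 3 \<tau> f] ! i" for i
    define c where "c i = [1, \<tau>, \<tau>\<^sup>2 / 2, 1] ! i" for i
    have I: "{..<4} = {0, 1, 2, 3::nat}" by auto
    have "\<exists>l d. pol_bd 0 l d f" "\<exists>l d. pol_bd 0 l d (B f)" "\<exists>l d. pol_bd 0 l d (B (B f))"
      "\<exists>l d. pol_bd 0 l d (flow_rem b \<kappa> 3 \<tau> f)"
      by (rule exI exI f0 pol_bd_Suc_le[OF Bf] BBf rem)+
    then have "\<exists>l d. pol_bd 0 l d (G i)" if "i \<in> {..<4}" for i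
      using that unfolding I G_def by (elim insertE emptyE) (simp_all del: pol_bd.simps)
    then obtain l d where ld: "\<And>i. i \<in> {..<4} \<Longrightarrow> pol_bd 0 (l i) (d i) (G i)"
      by metis
    have "heat_mean s Ef x = heat_mean s (\<lambda>z. \<Sum>i\<in>{..<4}. c i * G i z) x"
      by (rule heat_mean_cong[OF _ x]) (simp add: I G_def c_def Ef_def flow3[of f])
    also have "\<dots> = (\<Sum>i\<in>{..<4}. c i * heat_mean s (G i) x)"
      by (rule heat_mean_lincomb[OF ld x])
    finally show ?thesis
      by (simp add: I G_def c_def)
  qed
  also have "\<dots> = f y + t * cir_gen a b \<sigma> f y + t\<^sup>2 / 2 * cir_gen a b \<sigma> (cir_gen a b \<sigma> f) y
      + scheme_error b \<kappa> \<sigma> t f y"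
    \<comment> \<open>Coefficients: B gets 2\<tau> = t and A gets e; B B gets \<tau>^2/2 + \<tau>^2
      + \<tau>^2/2 = t^2/2; A B and B A each get e \<tau> = t^2/2 times \<sigma>^2/8, the symmetry
      that yields second order; A A gets e^2/2.\<close>
    unfolding cir_gen_cir_gen_eq[OF f4 assms(4)] fun_cong[OF cir_gen_eq, of a b \<sigma> f y] \<kappa>_def[symmetric] B_def[symmetric]
      scheme_error_def \<tau>_def[symmetric] s_def[symmetric] x_def[symmetric]
      hm3[of f] hm2[of "B f"] hm1[of "B (B f)"] fl3[of f] fl2[of "diff_gen f"] fl1[of "diff_gen (diff_gen f)"]
      fl2[of "B f"] fl1[of "diff_gen (B f)"] fl1[of "B (B f)"] e
    by (simp add: \<tau>_def power2_eq_square field_simps eval_nat_numeral)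
  finally show "(\<integral>\<omega>. f (Y_hat a b \<sigma> t y (Z \<omega>)) \<partial>M) =
      f y + t * cir_gen a b \<sigma> f y + t\<^sup>2 / 2 * cir_gen a b \<sigma> (cir_gen a b \<sigma> f) y
      + scheme_error b (a - \<sigma>\<^sup>2 / 4) \<sigma> t f y"
    unfolding \<kappa>_def .
qed

end

theorem proposition1p2p9:
  fixes M :: "'w measure" and Z :: "'w \<Rightarrow> real"
    and a b \<sigma> T :: real and m L :: nat
  assumes "\<sigma> > 0" and "a \<ge> 0" and "\<sigma>\<^sup>2 \<le> 4 * a" and "T > 0"
    and "prob_space M" and "Z \<in> borel_measurable M"
    and symmetric: "distr M borel (\<lambda>\<omega>. - Z \<omega>) = distr M borel Z"
    and moments: "\<And>k::nat. integrable M (\<lambda>\<omega>. \<bar>Z \<omega>\<bar> ^ k)"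
    and "(\<integral>\<omega>. Z \<omega> ^ 2 \<partial>M) = 1"
    and "(\<integral>\<omega>. Z \<omega> ^ 4 \<partial>M) = 3"
    and "L \<ge> 1"
  shows "\<exists>C::real. \<exists>R :: (real \<Rightarrow> real) \<Rightarrow> real \<Rightarrow> real \<Rightarrow> real.
    \<forall>f \<in> C_pol (2 * (m + 3)) L. \<forall>t \<in> {0..T}.
      (\<forall>y\<ge>0. integrable M (\<lambda>\<omega>. f (Y_hat a b \<sigma> t y (Z \<omega>))) \<and>
        (\<integral>\<omega>. f (Y_hat a b \<sigma> t y (Z \<omega>)) \<partial>M) =
          f y + t * cir_gen a b \<sigma> f y + t\<^sup>2 / 2 * cir_gen a b \<sigma> (cir_gen a b \<sigma> f) y
          + R f t y) \<and>
      R f t \<in> C_pol m (L + 3) \<and>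
      pol_norm m (L + 3) (R f t) \<le> ereal (C * t ^ 3) * pol_norm (2 * (m + 3)) L f"
proof -
  interpret moment_matched M Z
    using assms(5-10) by (intro moment_matched.intro moment_matched_axioms.intro)
  \<comment> \<open>The condition on \<sigma> and \<open>a\<close> makes \<kappa> nonnegative, which
    keeps the flow in the half line.\<close>
  have k: "0 \<le> a - \<sigma>\<^sup>2 / 4" using assms(3) by simp
  obtain C where C: "\<And>t f K. t \<in> {0..T} \<Longrightarrow> pol_bd (2 * (m + 3)) L K f \<Longrightarrow>
      pol_bd m (L + 3) (C * t ^ 3 * K) (scheme_error b (a - \<sigma>\<^sup>2 / 4) \<sigma> t f)"
    using order_bd_scheme_error[OF k less_imp_le[OF assms(4)], of m L b \<sigma>] unfolding order_bd_def by blast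
  show ?thesis
  \<comment> \<open>The witness for \<open>R\<close> is \<open>scheme_error\<close> and
    \<open>C\<close> is the uniform constant just obtained. Taking for \<open>K\<close> the value of
    the norm of \<open>f\<close> turns the \<open>pol_bd\<close> estimate into the norm
    inequality.\<close>
  proof (intro exI ballI)
    fix f t assume f: "f \<in> C_pol (2 * (m + 3)) L" and t: "t \<in> {0..T}"
    obtain K where K: "pol_norm (2 * (m + 3)) L f = ereal K" "pol_bd (2 * (m + 3)) L K f"
      using C_pol_imp_pol_bd[OF f] .
    have f6: "pol_bd 6 L K f" by (rule pol_bd_le[OF K(2)]) simp
    have "0 \<le> t" using t by simp
    with scheme_expansion[OF f6 k] pol_bd_imp_C_pol[OF C[OF t K(2)]] K(1)
    show "(\<forall>y\<ge>0. integrable M (\<lambda>\<omega>. f (Y_hat a b \<sigma> t y (Z \<omega>))) \<and>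
        (\<integral>\<omega>. f (Y_hat a b \<sigma> t y (Z \<omega>)) \<partial>M) =
          f y + t * cir_gen a b \<sigma> f y + t\<^sup>2 / 2 * cir_gen a b \<sigma> (cir_gen a b \<sigma> f) y
          + scheme_error b (a - \<sigma>\<^sup>2 / 4) \<sigma> t f y) \<and>
      scheme_error b (a - \<sigma>\<^sup>2 / 4) \<sigma> t f \<in> C_pol m (L + 3) \<and>
      pol_norm m (L + 3) (scheme_error b (a - \<sigma>\<^sup>2 / 4) \<sigma> t f)
        \<le> ereal (C * t ^ 3) * pol_norm (2 * (m + 3)) L f"
      by simp
  qed
qed

end
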